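(* Let $C$ and $D$ be perfect binary codes of lengths $t$ and $m$ respectively, containing the all-zero words, and let $G=\mathrm{Stab}_{D^2}\mathrm{Sym}(M(C,D))$ be the setwise stabilizer of the subcode $D^2$ in the symmetry group of the Mollard code $M(C,D)$. Then $$G=\bigl(\mathcal{D}ub_1(\mathrm{Sym}(C))\rightthreetimes \langle Ort_{Lin_{\mu}(D)}(C^{\perp})\rangle\bigr)\times \mathcal{D}ub_2(\mathrm{Sym}(D)),$$ where $\rightthreetimes$ denotes the internal semidirect product (with $\langle Ort_{Lin_{\mu}(D)}(C^{\perp})\rangle$ the normal factor) and $\times$ denotes the direct product.
   Context: A perfect code of length $n$ is a set $C\subseteq \mathbf{F}_2^n$ such that every binary vector of length $n$ is at Hamming distance at most 1 from exactly one codeword of $C$; perfect codes have length $2^k-1$ and minimum distance 3 (so length at least 3). All perfect codes are assumed to contain the all-zero word. $\mathrm{STS}(C)$ is the Steiner triple system formed by the supports of the weight-3 codewords of $C$. Mollard code: coordinates are indexed by pairs $(r,s)\in(\{0,\dots,t\}\times\{0,\dots,m\})\setminus\{(0,0)\}$. For $z\in\mathbf{F}_2^{tm+t+m}$ put $p_1(z)=(\sum_{s=0}^m z_{1,s},\dots,\sum_{s=0}^m z_{t,s})$, $p_2(z)=(\sum_{r=0}^t z_{r,1},\dots,\sum_{r=0}^t z_{r,m})$. Then $M(C,D)=\{z: p_1(z)\in C,\ p_2(z)\in D\}$, which is a perfect code. For $y\in D$, $y^2\in M(C,D)$ is the vector with $(y^2)_{0,s}=y_s$ for $s\in\{1,\dots,m\}$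 and zeros elsewhere; $D^2=\{y^2:y\in D\}$. $\mathrm{Sym}(C)$ is the group of coordinate permutations $\pi$ with $\pi(C)=C$. $\mathrm{Stab}_{D^2}\mathrm{Sym}(M(C,D))$ consists of those $\sigma\in \mathrm{Sym}(M(C,D))$ with $\sigma(D^2)=D^2$; equivalently, $\sigma$ maps the coordinate set $\{(0,s):1\le s\le m\}$ onto itself. For a permutation $\pi$ of $\{1,\dots,t\}$, $\mathcal{D}ub_1(\pi)(r,s)=(\pi(r),s)$ if $r\ne0$ and $\mathcal{D}ub_1(\pi)(0,s)=(0,s)$. For a permutation $\pi$ of $\{1,\dots,m\}$, $\mathcal{D}ub_2(\pi)(r,s)=(r,\pi(s))$ if $s\neq 0$ and $\mathcal{D}ub_2(\pi)(r,0)=(r,0)$. For a set $\Pi$ of permutations, $\mathcal{D}ub_i(\Pi)=\{\mathcal{D}ub_i(\pi):\pi\in\Pi\}$. $\mathrm{Ker}(D)=\{x\in D: x+D=D\}$; $\mu_i(D)$ is the number of weight-3 codewords in $\mathrm{Ker}(D)$ whose support contains $i$; $Lin_\mu(D)$ is the set of coordinates $i$ with $\mu_i(D)=(m-1)/2$ (the maximal possible value). $C^\perp$ is the set of vectors orthogonal over $\mathbf{F}_2$ to all codewords of $C$. The Steiner loop of $\mathrm{STS}(D)$ is $(\{0,1,\dots,m\},\star)$ with $i\star j=k$ if $\{i,j,k\}\in\mathrm{STS}(D)$, $i\star i=0$, $i\star 0=0\star i=i$. For $u\in C^\perp$, $l\in Lin_\mu(D)$: $Ort_l(u)(r,s)=(r,s\star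 l)$ for $r\in \mathrm{supp}(u)$, $s\in\{0,\dots,m\}$, and $Ort_l(u)(r,s)=(r,s)$ otherwise. $Ort_A(U)=\{Ort_l(u): l\in A,u\in U\}$, and $\langle\cdot\rangle$ denotes the generated group.
   Formalization: The outer × is false in general (e.g. C = D = {000,111}): proved instead is a semidirect product with the bracketed factor normal, and that it is a direct product exactly when C^⊥ = {0} or Sym(D) fixes Lin_μ(D) pointwise. *)

theory Defs
  imports
    Complex_Main
    "HOL-Library.Z2"
    "HOL-Library.Function_Algebras"
    "HOL-Combinatorics.Permutations"
    "HOL-Algebra.Coset"
    "HOL-Algebra.Generated_Groups"
begin

section \<open>Binary vectors and perfect codes\<close>

text \<open>
  A vector over the two-element field with finite coordinate set \<open>I\<close> is a function into \<open>bit\<close>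
  that vanishes outside \<open>I\<close>; addition and the all-zero vector are pointwise. The coordinate
  set is \<open>{1..n}\<close> for a code of length \<open>n\<close>, and a set of pairs for the Mollard code.
\<close>

definition vectors :: "'i set \<Rightarrow> ('i \<Rightarrow> bit) set" where
  "vectors I = {x. \<forall>i. i \<notin> I \<longrightarrow> x i = 0}"

definition supp :: "('i \<Rightarrow> bit) \<Rightarrow> 'i set" where
  "supp x = {i. x i \<noteq> 0}"

definition hamming_dist :: "'i set \<Rightarrow> ('i \<Rightarrow> bit) \<Rightarrow> ('i \<Rightarrow> bit) \<Rightarrow> nat" where
  "hamming_dist I x y = card {i \<in> I. x i \<noteq> y i}"

definition perfect_code :: "'i set \<Rightarrow> ('i \<Rightarrow> bit) set \<Rightarrow> bool" where
  "perfect_code I C \<longleftrightarrow>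
     C \<subseteq> vectors I \<and> (\<forall>x \<in> vectors I. \<exists>!c. c \<in> C \<and> hamming_dist I x c \<le> 1)"

definition dual_code :: "'i set \<Rightarrow> ('i \<Rightarrow> bit) set \<Rightarrow> ('i \<Rightarrow> bit) set" where
  "dual_code I C = {u \<in> vectors I. \<forall>c \<in> C. (\<Sum>i\<in>I. u i * c i) = 0}"

definition kernel_code :: "('i \<Rightarrow> bit) set \<Rightarrow> ('i \<Rightarrow> bit) set" where
  "kernel_code D = {x \<in> D. (\<lambda>y. x + y) ` D = D}"

definition mu :: "('i \<Rightarrow> bit) set \<Rightarrow> 'i \<Rightarrow> nat" where
  "mu D i = card {x \<in> kernel_code D. card (supp x) = 3 \<and> i \<in> supp x}"

definition Lin_mu :: "nat \<Rightarrow> (nat \<Rightarrow> bit) set \<Rightarrow> nat set" where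
  "Lin_mu m D = {i \<in> {1..m}. real (mu D i) = (real m - 1) / 2}"

section \<open>Coordinate permutations\<close>

definition perm_group :: "'i set \<Rightarrow> ('i \<Rightarrow> 'i) monoid" where
  "perm_group I = \<lparr>carrier = {p. p permutes I}, mult = (\<circ>), one = id\<rparr>"

text \<open>\<open>p\<close> moves the entry at coordinate \<open>i\<close> to coordinate \<open>p i\<close>, so supports are mapped by \<open>p\<close>.\<close>

definition perm_vec :: "('i \<Rightarrow> 'i) \<Rightarrow> ('i \<Rightarrow> bit) \<Rightarrow> ('i \<Rightarrow> bit)" where
  "perm_vec p x = (\<lambda>i. x (inv_into UNIV p i))"

definition Sym_code :: "'i set \<Rightarrow> ('i \<Rightarrow> bit) set \<Rightarrow> ('i \<Rightarrow> 'i) set" where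
  "Sym_code I C = {p. p permutes I \<and> perm_vec p ` C = C}"

definition Stab_Sym :: "'i set \<Rightarrow> ('i \<Rightarrow> bit) set \<Rightarrow> ('i \<Rightarrow> bit) set \<Rightarrow> ('i \<Rightarrow> 'i) set" where
  "Stab_Sym I E M = {p \<in> Sym_code I M. perm_vec p ` E = E}"

section \<open>The Mollard code\<close>

definition mollard_coords :: "nat \<Rightarrow> nat \<Rightarrow> (nat \<times> nat) set" where
  "mollard_coords t m = ({0..t} \<times> {0..m}) - {(0, 0)}"

definition parity1 :: "nat \<Rightarrow> nat \<Rightarrow> (nat \<times> nat \<Rightarrow> bit) \<Rightarrow> (nat \<Rightarrow> bit)" where
  "parity1 t m z = (\<lambda>r. if r \<in> {1..t} then \<Sum>s=0..m. z (r, s) else 0)"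

definition parity2 :: "nat \<Rightarrow> nat \<Rightarrow> (nat \<times> nat \<Rightarrow> bit) \<Rightarrow> (nat \<Rightarrow> bit)" where
  "parity2 t m z = (\<lambda>s. if s \<in> {1..m} then \<Sum>r=0..t. z (r, s) else 0)"

definition mollard ::
    "nat \<Rightarrow> nat \<Rightarrow> (nat \<Rightarrow> bit) set \<Rightarrow> (nat \<Rightarrow> bit) set \<Rightarrow> (nat \<times> nat \<Rightarrow> bit) set" where
  "mollard t m C D =
     {z \<in> vectors (mollard_coords t m). parity1 t m z \<in> C \<and> parity2 t m z \<in> D}"

definition embed2 :: "nat \<Rightarrow> (nat \<Rightarrow> bit) \<Rightarrow> (nat \<times> nat \<Rightarrow> bit)" where
  "embed2 m y = (\<lambda>(r, s). if r = 0 \<and> s \<in> {1..m} then y s else 0)"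

text \<open>
  The maps below are restricted to \<open>{0..t} \<times> {0..m}\<close> so that, being the identity outside the
  coordinate set, they are permutations in the sense of \<open>permutes\<close>.
\<close>

definition Dub1 :: "nat \<Rightarrow> (nat \<Rightarrow> nat) \<Rightarrow> (nat \<times> nat \<Rightarrow> nat \<times> nat)" where
  "Dub1 m p = (\<lambda>(r, s). if r \<noteq> 0 \<and> s \<in> {0..m} then (p r, s) else (r, s))"

definition Dub2 :: "nat \<Rightarrow> (nat \<Rightarrow> nat) \<Rightarrow> (nat \<times> nat \<Rightarrow> nat \<times> nat)" where
  "Dub2 t p = (\<lambda>(r, s). if s \<noteq> 0 \<and> r \<in> {0..t} then (r, p s) else (r, s))"

definition STS :: "('i \<Rightarrow> bit) set \<Rightarrow> 'i set set" where
  "STS D = {supp x | x. x \<in> D \<and> card (supp x) = 3}"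

text \<open>The Steiner loop is only meant on \<open>{0..m}\<close>, where the \<open>THE\<close> below is well defined.\<close>

definition steiner_loop :: "(nat \<Rightarrow> bit) set \<Rightarrow> nat \<Rightarrow> nat \<Rightarrow> nat" where
  "steiner_loop D i j =
     (if i = 0 then j else if j = 0 then i else if i = j then 0
      else (THE k. {i, j, k} \<in> STS D))"

definition Ort ::
    "nat \<Rightarrow> (nat \<Rightarrow> bit) set \<Rightarrow> nat \<Rightarrow> (nat \<Rightarrow> bit) \<Rightarrow> (nat \<times> nat \<Rightarrow> nat \<times> nat)" where
  "Ort m D l u =
     (\<lambda>(r, s). if r \<in> supp u \<and> s \<in> {0..m} then (r, steiner_loop D s l) else (r, s))"

definition Ort_set ::
    "nat \<Rightarrow> (nat \<Rightarrow> bit) set \<Rightarrow> nat set \<Rightarrow> (nat \<Rightarrow> bit) set \<Rightarrow> (nat \<times> nat \<Rightarrow> nat \<times> nat) set" where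
  "Ort_set m D A U = {Ort m D l u | l u. l \<in> A \<and> u \<in> U}"

section \<open>Internal products of subgroups\<close>

text \<open>\<open>L\<close> is the internal semidirect product of \<open>K\<close> and \<open>N\<close>, with \<open>N\<close> the normal factor.\<close>

definition internal_semidirect_product ::
    "('a, 'b) monoid_scheme \<Rightarrow> 'a set \<Rightarrow> 'a set \<Rightarrow> 'a set \<Rightarrow> bool" where
  "internal_semidirect_product P K N L \<longleftrightarrow>
     subgroup L P \<and> subgroup K P \<and> N \<lhd> (P\<lparr>carrier := L\<rparr>) \<and>
     K <#>\<^bsub>P\<^esub> N = L \<and> K \<inter> N = {\<one>\<^bsub>P\<^esub>}"

definition internal_direct_product ::
    "('a, 'b) monoid_scheme \<Rightarrow> 'a set \<Rightarrow> 'a set \<Rightarrow> 'a set \<Rightarrow> bool" where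
  "internal_direct_product P H K L \<longleftrightarrow>
     subgroup L P \<and> H \<lhd> (P\<lparr>carrier := L\<rparr>) \<and> K \<lhd> (P\<lparr>carrier := L\<rparr>) \<and>
     H <#>\<^bsub>P\<^esub> K = L \<and> H \<inter> K = {\<one>\<^bsub>P\<^esub>}"

text \<open>
  For \<open>p\<close> in the symmetry group of \<open>D\<close>, conjugation by \<open>Dub2 t p\<close> carries \<open>Ort m D l u\<close> to
  \<open>Ort m D (p l) u\<close>. Hence \<open>Dub2\<close> of that group commutes with \<open>Dub1\<close> of the symmetry group
  of \<open>C\<close>, but in general it only normalizes the group generated by the \<open>Ort\<close> maps. For
  example, for \<open>C\<close> and \<open>D\<close> both the Hamming code of length 3 the stabilizer is not
  the direct product of its two outer factors: the second one is not normal.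
\<close>

end

theory Submission
  imports Defs
begin

text \<open>
  Modulo the kernel of \<open>D\<close>, a coordinate \<open>l\<close> lies in \<open>Lin_mu m D\<close> exactly when translation by \<open>l\<close>
  in the Steiner loop agrees with adding the \<open>l\<close>-th unit vector. An element of the stabilizer acts
  on row \<open>0\<close> as a symmetry of \<open>D\<close>; after dividing it out, the codewords of weight 3 force rows to
  be mapped to rows, by a symmetry of \<open>C\<close>. What remains fixes row \<open>0\<close> pointwise and every other
  row \<open>r\<close> setwise, acting there as translation by some \<open>\<lambda>\<^sub>r \<in> Lin_mu m D \<union> {0}\<close>, and preserving the code
  means that the \<open>\<lambda>\<^sub>r\<close> with \<open>r\<close> in the support of a codeword of \<open>C\<close> have trivial product. Filtering
  the elementary abelian group \<open>Lin_mu m D \<union> {0}\<close> by subgroups of index 2 writes such a map as a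
  product of maps \<open>Ort m D l u\<close>.
\<close>


section \<open>Internal products\<close>

text \<open>The group generated by the maps \<open>Ort\<close> is identified with
  \<open>row_kernel\<close>, a set described without generators, so that its invariance under
  conjugation by both other factors needs no conjugation formula. The difficulty is to show that
  every element of \<open>row_kernel\<close> is generated. The Steiner loop of \<open>D\<close> need
  not be associative, so a product of several shifts has no meaning by itself; every such product is
  replaced by a sum of unit vectors modulo the kernel. No information is lost, because distinct
  coordinates, and 0, stay distinct modulo the kernel: the minimum distance is 3. The kernel enters
  through row 0. This row is invisible to the first parity, so points of it can be added freely to
  steer the second parity to any word of \<open>D\<close>. Subgroups of index 2 appear because a
  single \<open>Ort m D l u\<close> only separates rows into two classes, moved and unmoved;
  membership in such a subgroup is a binary functional, and this is what makes the indicator of the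
  moved rows orthogonal to \<open>C\<close>.\<close>

context group
begin

lemma mem_set_mult_iff: "x \<in> H <#> K \<longleftrightarrow> (\<exists>h \<in> H. \<exists>k \<in> K. x = h \<otimes> k)"
  by (auto simp: set_mult_def)

lemma set_mult_commute:
  assumes "\<And>h k. h \<in> H \<Longrightarrow> k \<in> K \<Longrightarrow> h \<otimes> k = k \<otimes> h"
  shows "H <#> K = K <#> H"
proof (rule Set.set_eqI)
  fix x
  have "(\<exists>h \<in> H. \<exists>k \<in> K. x = h \<otimes> k) \<longleftrightarrow> (\<exists>h \<in> H. \<exists>k \<in> K. x = k \<otimes> h)"
    using assms by metis
  then show "x \<in> H <#> K \<longleftrightarrow> x \<in> K <#> H"
    unfolding mem_set_mult_iff by blast
qed

lemma inv_m_cancel: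
  assumes "x \<in> carrier G" "y \<in> carrier G"
  shows "inv x \<otimes> (x \<otimes> y) = y" "x \<otimes> (inv x \<otimes> y) = y"
  using assms by (simp_all add: m_assoc[symmetric])

lemma normal_in_subgroup_iff:
  assumes L: "subgroup L G"
  shows "N \<lhd> G\<lparr>carrier := L\<rparr> \<longleftrightarrow>
    subgroup N G \<and> N \<subseteq> L \<and> (\<forall>x \<in> L. \<forall>h \<in> N. x \<otimes> h \<otimes> inv x \<in> N)"
proof -
  interpret L: group "G\<lparr>carrier := L\<rparr>"
    using L by (rule subgroup_imp_group)
  have "subgroup N (G\<lparr>carrier := L\<rparr>) \<longleftrightarrow> subgroup N G \<and> N \<subseteq> L"
    using incl_subgroup[OF L] subgroup_incl[OF _ L] subgroup.subset[of N "G\<lparr>carrier := L\<rparr>"] by auto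
  moreover have "inv\<^bsub>G\<lparr>carrier := L\<rparr>\<^esub> x = inv x" if "x \<in> L" for x
    using m_inv_consistent[OF L that] .
  ultimately show ?thesis
    unfolding L.normal_inv_iff by auto
qed

lemma internal_semidirect_productI:
  assumes K: "subgroup K G" and N: "subgroup N G"
    and conj: "\<And>k n. k \<in> K \<Longrightarrow> n \<in> N \<Longrightarrow> k \<otimes> n \<otimes> inv k \<in> N"
    and triv: "K \<inter> N = {\<one>}"
  shows "internal_semidirect_product G K N (K <#> N)"
proof -
  interpret K: subgroup K G by (rule K)
  interpret N: subgroup N G by (rule N)
  have conj': "inv k \<otimes> n \<otimes> k \<in> N" if "k \<in> K" "n \<in> N" for k n
    using conj[of "inv k" n] that by simp
  have L: "subgroup (K <#> N) G"
  proof
    show "K <#> N \<subseteq> carrier G"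
      by (auto simp: mem_set_mult_iff)
    show "x \<otimes> y \<in> K <#> N" if "x \<in> K <#> N" "y \<in> K <#> N" for x y
    proof -
      obtain k n k' n' where *: "k \<in> K" "n \<in> N" "x = k \<otimes> n" "k' \<in> K" "n' \<in> N" "y = k' \<otimes> n'"
        using \<open>x \<in> K <#> N\<close> \<open>y \<in> K <#> N\<close> unfolding mem_set_mult_iff by blast
      have "x \<otimes> y = (k \<otimes> k') \<otimes> ((inv k' \<otimes> n \<otimes> k') \<otimes> n')"
        using * by (simp add: m_assoc inv_m_cancel)
      with * conj' show ?thesis
        unfolding mem_set_mult_iff by blast
    qed
    have "\<one> = \<one> \<otimes> \<one>" by simp
    then show "\<one> \<in> K <#> N"
      unfolding mem_set_mult_iff using K.one_closed N.one_closed by blast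
    show "inv x \<in> K <#> N" if "x \<in> K <#> N" for x
    proof -
      obtain k n where *: "k \<in> K" "n \<in> N" "x = k \<otimes> n"
        using \<open>x \<in> K <#> N\<close> unfolding mem_set_mult_iff by blast
      have "inv x = inv k \<otimes> (k \<otimes> inv n \<otimes> inv k)"
        using * by (simp add: m_assoc inv_m_cancel inv_mult_group)
      with * conj[of k "inv n"] show ?thesis
        unfolding mem_set_mult_iff by blast
    qed
  qed
  have "N \<subseteq> K <#> N"
  proof
    fix n assume "n \<in> N"
    moreover from this have "n = \<one> \<otimes> n" by simp
    ultimately show "n \<in> K <#> N"
      unfolding mem_set_mult_iff using K.one_closed by blast
  qed
  moreover have "x \<otimes> h \<otimes> inv x \<in> N" if "x \<in> K <#> N" "h \<in> N" for x h
  proof -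
    obtain k n where *: "k \<in> K" "n \<in> N" "x = k \<otimes> n"
      using \<open>x \<in> K <#> N\<close> unfolding mem_set_mult_iff by blast
    have "x \<otimes> h \<otimes> inv x = k \<otimes> (n \<otimes> h \<otimes> inv n) \<otimes> inv k"
      using * that by (simp add: m_assoc inv_mult_group)
    with * that conj show ?thesis by simp
  qed
  ultimately show ?thesis
    unfolding internal_semidirect_product_def normal_in_subgroup_iff[OF L]
    using K N L triv by blast
qed

text \<open>Since \<open>A\<close> and \<open>B\<close> commute and both normalize \<open>N\<close>,
  the product of the three can be bracketed in either way. The single hypothesis \<open>triv\<close>
  yields every trivial intersection that occurs. For the last claim, \<open>B\<close> already
  centralizes \<open>A\<close>, so only its action on \<open>N\<close> can keep it from being
  normal.\<close>

lemma internal_products_of_three: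
  assumes A: "subgroup A G" and B: "subgroup B G" and N: "subgroup N G" and L: "subgroup L G"
    and incl: "A \<subseteq> L" "B \<subseteq> L" "N \<subseteq> L"
    and comm: "\<And>a b. a \<in> A \<Longrightarrow> b \<in> B \<Longrightarrow> b \<otimes> a = a \<otimes> b"
    and conjA: "\<And>a n. a \<in> A \<Longrightarrow> n \<in> N \<Longrightarrow> a \<otimes> n \<otimes> inv a \<in> N"
    and conjB: "\<And>b n. b \<in> B \<Longrightarrow> n \<in> N \<Longrightarrow> b \<otimes> n \<otimes> inv b \<in> N"
    and cover: "\<And>g. g \<in> L \<Longrightarrow> \<exists>b \<in> B. \<exists>a \<in> A. \<exists>n \<in> N. g = b \<otimes> (a \<otimes> n)"
    and triv: "\<And>a b. a \<in> A \<Longrightarrow> b \<in> B \<Longrightarrow> b \<otimes> a \<in> N \<Longrightarrow> a = \<one> \<and> b = \<one>"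
  shows "internal_semidirect_product G A N (A <#> N)"
    and "internal_semidirect_product G B (A <#> N) L"
    and "internal_direct_product G A B (A <#> B)"
    and "internal_semidirect_product G (A <#> B) N L"
    and "internal_direct_product G (A <#> N) B L \<longleftrightarrow> (\<forall>b \<in> B. \<forall>n \<in> N. b \<otimes> n = n \<otimes> b)"
proof -
  interpret A: subgroup A G by (rule A)
  interpret B: subgroup B G by (rule B)
  interpret N: subgroup N G by (rule N)
  interpret L: subgroup L G by (rule L)
  have set_mult_L: "H <#> K \<subseteq> L" if "H \<subseteq> L" "K \<subseteq> L" for H K
    using that L.m_closed unfolding set_mult_def by blast
  have 1: "A \<inter> N = {\<one>}"
    using triv[of _ "\<one>"] by auto
  have 2: "A \<inter> B = {\<one>}"
  proof -
    have "x = \<one>" if "x \<in> A" "x \<in> B" for x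
      using triv[of x "inv x"] that by simp
    then show ?thesis by auto
  qed
  have 3: "(A <#> B) \<inter> N = {\<one>}"
  proof -
    have "x = \<one>" if "x \<in> A <#> B" "x \<in> N" for x
    proof -
      obtain a b where "a \<in> A" "b \<in> B" "x = b \<otimes> a"
        using \<open>x \<in> A <#> B\<close> comm unfolding mem_set_mult_iff by force
      with that triv show ?thesis by auto
    qed
    moreover have "\<one> = \<one> \<otimes> \<one>" by simp
    then have "\<one> \<in> A <#> B"
      unfolding mem_set_mult_iff using A.one_closed B.one_closed by blast
    ultimately show ?thesis using N.one_closed B.one_closed by blast
  qed
  have 4: "B \<inter> (A <#> N) = {\<one>}"
  proof -
    have "x = \<one>" if "x \<in> A <#> N" "x \<in> B" for x
    proof -
      obtain a n where *: "a \<in> A" "n \<in> N" "x = a \<otimes> n"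
        using \<open>x \<in> A <#> N\<close> unfolding mem_set_mult_iff by blast
      \<comment> \<open>As \<open>x\<close> lies in \<open>B\<close>, it commutes with
        \<open>inv a\<close>; so \<open>x \<otimes> inv a\<close> equals \<open>n\<close>, and
        \<open>triv\<close> applies to \<open>inv a\<close> and \<open>x\<close>.\<close>
      have "x \<otimes> inv a = inv a \<otimes> x"
        using comm[of "inv a" x] * that by simp
      then have "x \<otimes> inv a = n"
        using * by (simp add: inv_m_cancel)
      then show ?thesis
        using triv[of "inv a" x] * that by auto
    qed
    moreover have "\<one> = \<one> \<otimes> \<one>" by simp
    then have "\<one> \<in> A <#> N"
      unfolding mem_set_mult_iff using A.one_closed N.one_closed by blast
    ultimately show ?thesis using N.one_closed B.one_closed by blast
  qed
  show AN: "internal_semidirect_product G A N (A <#> N)"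
    using A N conjA 1 by (rule internal_semidirect_productI)
  have conjAB: "b \<otimes> a \<otimes> inv b = a" if "a \<in> A" "b \<in> B" for a b
    using that comm by (simp add: m_assoc)
  have "internal_semidirect_product G B A (B <#> A)"
    using conjAB 2 by (intro internal_semidirect_productI A B) auto
  moreover have "internal_semidirect_product G A B (A <#> B)"
  proof (rule internal_semidirect_productI[OF A B _ 2])
    show "a \<otimes> b \<otimes> inv a \<in> B" if "a \<in> A" "b \<in> B" for a b
      using that comm[OF that, symmetric] by (simp add: m_assoc)
  qed
  moreover have "B <#> A = A <#> B"
    using comm by (rule set_mult_commute)
  ultimately show AB: "internal_direct_product G A B (A <#> B)"
    using 2 unfolding internal_direct_product_def internal_semidirect_product_def by simp
  have subAN: "subgroup (A <#> N) G" and subAB: "subgroup (A <#> B) G"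
    using AN AB by (simp_all add: internal_semidirect_product_def internal_direct_product_def)
  have conj_AN: "b \<otimes> x \<otimes> inv b \<in> A <#> N" if "b \<in> B" "x \<in> A <#> N" for b x
  proof -
    obtain a n where *: "a \<in> A" "n \<in> N" "x = a \<otimes> n"
      using \<open>x \<in> A <#> N\<close> unfolding mem_set_mult_iff by blast
    have "b \<otimes> x \<otimes> inv b = (b \<otimes> a) \<otimes> (n \<otimes> inv b)"
      using * that by (simp add: m_assoc)
    also have "\<dots> = a \<otimes> (b \<otimes> n \<otimes> inv b)"
      using * that comm[of a b] by (simp add: m_assoc)
    finally show ?thesis
      using * that conjB unfolding mem_set_mult_iff by blast
  qed
  have BAN: "B <#> (A <#> N) = L"
  proof
    show "B <#> (A <#> N) \<subseteq> L"
      using set_mult_L[OF incl(2) set_mult_L[OF incl(1,3)]] .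
    show "L \<subseteq> B <#> (A <#> N)"
    proof
      fix g assume "g \<in> L"
      then obtain b a n where *: "b \<in> B" "a \<in> A" "n \<in> N" "g = b \<otimes> (a \<otimes> n)"
        using cover by blast
      then have "a \<otimes> n \<in> A <#> N"
        unfolding mem_set_mult_iff by blast
      with * show "g \<in> B <#> (A <#> N)"
        unfolding mem_set_mult_iff[of _ B] by blast
    qed
  qed
  show sBAN: "internal_semidirect_product G B (A <#> N) L"
    using internal_semidirect_productI[OF B subAN conj_AN 4] BAN by simp
  have ABN: "(A <#> B) <#> N = L"
  proof
    show "(A <#> B) <#> N \<subseteq> L"
      using set_mult_L[OF set_mult_L[OF incl(1,2)] incl(3)] .
    show "L \<subseteq> (A <#> B) <#> N"
    proof
      fix g assume "g \<in> L"
      then obtain b a n where *: "b \<in> B" "a \<in> A" "n \<in> N" "g = b \<otimes> (a \<otimes> n)"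
        using cover by blast
      then have "g = (a \<otimes> b) \<otimes> n"
        using comm[of a b] by (simp add: m_assoc[symmetric])
      moreover have "a \<otimes> b \<in> A <#> B"
        using * unfolding mem_set_mult_iff by blast
      ultimately show "g \<in> (A <#> B) <#> N"
        using * unfolding mem_set_mult_iff[of _ _ N] by blast
    qed
  qed
  have conj_N: "x \<otimes> n \<otimes> inv x \<in> N" if "x \<in> A <#> B" "n \<in> N" for x n
  proof -
    obtain a b where *: "a \<in> A" "b \<in> B" "x = a \<otimes> b"
      using \<open>x \<in> A <#> B\<close> unfolding mem_set_mult_iff by blast
    have "x \<otimes> n \<otimes> inv x = a \<otimes> (b \<otimes> n \<otimes> inv b) \<otimes> inv a"
      using * that by (simp add: m_assoc inv_mult_group)
    with * that conjA conjB show ?thesis by simp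
  qed
  show "internal_semidirect_product G (A <#> B) N L"
    using internal_semidirect_productI[OF subAB N conj_N 3] ABN by simp
  show "internal_direct_product G (A <#> N) B L \<longleftrightarrow> (\<forall>b \<in> B. \<forall>n \<in> N. b \<otimes> n = n \<otimes> b)"
  proof
    assume "internal_direct_product G (A <#> N) B L"
    then have normB: "x \<otimes> b \<otimes> inv x \<in> B" if "x \<in> L" "b \<in> B" for x b
      using that by (auto simp: internal_direct_product_def normal_in_subgroup_iff[OF L])
    show "\<forall>b \<in> B. \<forall>n \<in> N. b \<otimes> n = n \<otimes> b"
    proof (intro ballI)
      fix b n assume *: "b \<in> B" "n \<in> N"
      \<comment> \<open>The commutator lies in \<open>B\<close> because \<open>B\<close> is assumed
        normal, and in \<open>N\<close> because \<open>B\<close> normalizes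
        \<open>N\<close>.\<close>
      define x where "x = b \<otimes> n \<otimes> inv b \<otimes> inv n"
      have "x = b \<otimes> (n \<otimes> inv b \<otimes> inv n)"
        using * by (simp add: x_def m_assoc)
      moreover have "n \<otimes> inv b \<otimes> inv n \<in> B"
        using * incl by (intro normB) auto
      ultimately have "x \<in> B"
        using * by simp
      moreover have "x \<in> N"
        using * conjB by (simp add: x_def)
      ultimately have "x = \<one>"
        using triv[of "\<one>" x] by simp
      moreover have "b \<otimes> n = x \<otimes> (n \<otimes> b)"
        using * by (simp add: x_def m_assoc inv_m_cancel)
      ultimately show "b \<otimes> n = n \<otimes> b"
        using * by simp
    qed
  next
    assume commN: "\<forall>b \<in> B. \<forall>n \<in> N. b \<otimes> n = n \<otimes> b"
    have commAN: "x \<otimes> b = b \<otimes> x" if "x \<in> A <#> N" "b \<in> B" for x b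
    proof -
      obtain a n where *: "a \<in> A" "n \<in> N" "x = a \<otimes> n"
        using \<open>x \<in> A <#> N\<close> unfolding mem_set_mult_iff by blast
      have nb: "n \<otimes> b = b \<otimes> n"
        using commN *(2) that(2) by metis
      have "x \<otimes> b = a \<otimes> b \<otimes> n"
        using * that nb by (simp add: m_assoc)
      also have "\<dots> = b \<otimes> x"
        using * that comm[of a b] by (simp add: m_assoc[symmetric])
      finally show ?thesis .
    qed
    have carr: "x \<in> carrier G" if "x \<in> A <#> N" for x
      using that subgroup.subset[OF subAN] by blast
    have "(A <#> N) <#> B = B <#> (A <#> N)"
      using commAN by (rule set_mult_commute)
    moreover have "internal_semidirect_product G (A <#> N) B ((A <#> N) <#> B)"
    proof (rule internal_semidirect_productI[OF subAN B])
      show "x \<otimes> b \<otimes> inv x \<in> B" if "x \<in> A <#> N" "b \<in> B" for x b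
        using that commAN[OF that] carr by (simp add: m_assoc)
      show "(A <#> N) \<inter> B = {\<one>}" using 4 by blast
    qed
    ultimately show "internal_direct_product G (A <#> N) B L"
      using sBAN BAN 4
      unfolding internal_direct_product_def internal_semidirect_product_def by auto
  qed
qed

end

section \<open>Vectors and perfect codes\<close>

text \<open>\<open>\<delta> 0\<close> is the zero vector: this makes \<open>0\<close>, the identity of the Steiner loop, behave
  like the coordinates in all the sums below.\<close>

definition unit_vec :: "nat \<Rightarrow> nat \<Rightarrow> bit" ("\<delta>") where
  "\<delta> k = (\<lambda>i. if i = k \<and> k \<noteq> 0 then 1 else 0)"

lemma vec_add_self: "x + x = (0 :: 'i \<Rightarrow> bit)"
  by (rule ext) simp

lemma vec_add_cancel: "x + (x + y) = (y :: 'i \<Rightarrow> bit)"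
  by (simp add: add.assoc[symmetric] vec_add_self)

lemmas vec_simps = add.assoc add.commute add.left_commute vec_add_self vec_add_cancel

lemma sum_fun_apply: "(\<Sum>x\<in>S. f x) i = (\<Sum>x\<in>S. f x i)"
  by (induction S rule: infinite_finite_induct) auto

lemma unit_vec_0 [simp]: "\<delta> 0 = 0"
  by (rule ext) (simp add: unit_vec_def)

lemma unit_vec_eq_iff [simp]: "\<delta> a = \<delta> b \<longleftrightarrow> a = b"
proof
  assume *: "\<delta> a = \<delta> b"
  from fun_cong[OF *, of a] fun_cong[OF *, of b] show "a = b"
    by (auto simp: unit_vec_def split: if_splits)
qed simp

lemma unit_vec_in_vectors [simp]: "k \<le> n \<Longrightarrow> \<delta> k \<in> vectors {1..n}"
  by (auto simp: vectors_def unit_vec_def)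

lemma add_in_vectors: "x \<in> vectors I \<Longrightarrow> y \<in> vectors I \<Longrightarrow> x + y \<in> vectors I"
  by (simp add: vectors_def)

lemma supp_subset: "x \<in> vectors I \<Longrightarrow> supp x \<subseteq> I"
  by (auto simp: vectors_def supp_def)

lemma vec_eqI_supp: "supp x = supp y \<Longrightarrow> x = y"
  by (rule ext) (metis (mono_tags) supp_def mem_Collect_eq bit_not_one_iff bit_not_zero_iff)

lemma supp_unit_vec_sum:
  assumes "finite S" "0 \<notin> S"
  shows "supp (\<Sum>k\<in>S. \<delta> k) = S"
proof -
  have "(\<Sum>k\<in>S. \<delta> k) i = (\<Sum>k\<in>S. if k = i then 1 else 0)" for i
    unfolding sum_fun_apply using assms(2) by (intro sum.cong refl) (metis unit_vec_def)
  then show ?thesis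
    using assms by (auto simp: supp_def)
qed

text \<open>Words are written as sums of unit vectors over their supports, so that both the parity
  maps and coordinate permutations act summand by summand.\<close>

lemma vec_eq_sum:
  assumes "x \<in> vectors {1..n}"
  shows "(\<Sum>k\<in>supp x. \<delta> k) = x"
proof (rule vec_eqI_supp, rule supp_unit_vec_sum)
  show "finite (supp x)" "0 \<notin> supp x"
    using supp_subset[OF assms] finite_subset by auto
qed

text \<open>The value \<open>k = 0\<close> stands for the centre of the ball, so the
  \<open>n + 1\<close> points of a ball of radius 1 are indexed uniformly by
  \<open>k \<le> n\<close>.\<close>

lemma hamming_dist_le_one_iff:
  assumes x: "x \<in> vectors {1..n}" and c: "c \<in> vectors {1..n}"
  shows "hamming_dist {1..n} x c \<le> 1 \<longleftrightarrow> (\<exists>k \<le> n. c = x + \<delta> k)"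
proof
  let ?S = "{i \<in> {1..n}. x i \<noteq> c i}"
  have out: "x i = c i" if "i \<notin> {1..n}" for i
    using that x c by (simp add: vectors_def)
  assume "hamming_dist {1..n} x c \<le> 1"
  then have "card ?S \<le> Suc 0"
    by (simp add: hamming_dist_def)
  then obtain k where k: "k \<le> n" "?S = (if k = 0 then {} else {k})"
  proof -
    have "?S = {} \<or> (\<exists>k. ?S = {k})"
      using \<open>card ?S \<le> Suc 0\<close> card_le_Suc0_iff_eq[of ?S] by auto
    then show ?thesis
    proof
      assume "?S = {}"
      then show ?thesis using that[of 0] by simp
    next
      assume "\<exists>k. ?S = {k}"
      then obtain k where k: "?S = {k}" by blast
      then have "k \<in> {1..n}" by blast
      then show ?thesis using that[of k] k by simp
    qed
  qed
  have "c i = (x + \<delta> k) i" for i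
  proof (cases "i \<in> ?S")
    case True
    then have "i = k" "k \<noteq> 0" "x i \<noteq> c i" using k by (auto split: if_splits)
    then show ?thesis by (cases "x i"; cases "c i") (auto simp: unit_vec_def)
  next
    case False
    then have "x i = c i" "\<not> (i = k \<and> k \<noteq> 0)" using k out by auto
    then show ?thesis by (simp add: unit_vec_def)
  qed
  then show "\<exists>k \<le> n. c = x + \<delta> k"
    using k by blast
next
  assume "\<exists>k \<le> n. c = x + \<delta> k"
  then obtain k where k: "c = x + \<delta> k" by blast
  have "card {i \<in> {1..n}. x i \<noteq> c i} \<le> card {k}"
    by (rule card_mono) (auto simp: k unit_vec_def split: if_splits)
  then show "hamming_dist {1..n} x c \<le> 1"
    by (simp add: hamming_dist_def)
qed

lemma card_2_other:
  assumes "card S = 2" "a \<in> S"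
  shows "\<exists>k. S = {a, k} \<and> k \<noteq> a"
proof -
  obtain p q where pq: "S = {p, q}" "p \<noteq> q"
    using assms(1) unfolding card_2_iff by metis
  show ?thesis
  proof (cases "a = p")
    case True
    then show ?thesis using pq by (intro exI[of _ q]) auto
  next
    case False
    then show ?thesis using pq assms(2) by (intro exI[of _ p]) auto
  qed
qed

section \<open>Perfect codes containing zero, and the Steiner loop\<close>

locale perfect_code0 =
  fixes n :: nat and C :: "(nat \<Rightarrow> bit) set"
  assumes length_ge: "3 \<le> n" and perfect: "perfect_code {1..n} C" and zero_mem: "0 \<in> C"
begin

lemma mem_vectors: "c \<in> C \<Longrightarrow> c \<in> vectors {1..n}"
  using perfect by (auto simp: perfect_code_def)

lemma supp_codeword: "c \<in> C \<Longrightarrow> supp c \<subseteq> {1..n}"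
  using mem_vectors supp_subset by blast

lemma finite_code: "finite C"
proof (rule finite_imageD)
  show "finite (supp ` C)"
    by (rule finite_subset[of _ "Pow {1..n}"]) (use supp_codeword in auto)
  show "inj_on supp C"
    by (auto intro!: inj_onI vec_eqI_supp)
qed

text \<open>The source of all existence and uniqueness statements about the loop: for
  \<open>x = \<delta> i + \<delta> j\<close> the unique \<open>k\<close> is the loop product of
  \<open>i\<close> and \<open>j\<close>.\<close>

lemma ex1_neighbour:
  assumes "x \<in> vectors {1..n}"
  shows "\<exists>!k. k \<le> n \<and> x + \<delta> k \<in> C"
proof -
  from perfect assms obtain c where c: "c \<in> C" "hamming_dist {1..n} x c \<le> 1"
    and uniq: "\<And>d. d \<in> C \<Longrightarrow> hamming_dist {1..n} x d \<le> 1 \<Longrightarrow> d = c"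
    unfolding perfect_code_def by metis
  from c obtain k where k: "k \<le> n" "c = x + \<delta> k"
    using hamming_dist_le_one_iff[OF assms mem_vectors] by blast
  show ?thesis
  proof (intro ex1I[of _ k])
    fix k' assume *: "k' \<le> n \<and> x + \<delta> k' \<in> C"
    then have "x + \<delta> k' = c"
      using hamming_dist_le_one_iff[OF assms mem_vectors] uniq by blast
    with k show "k' = k" by simp
  qed (use k c in simp)
qed

text \<open>Minimum distance 3: both \<open>0\<close> and \<open>\<delta> a + \<delta> b\<close> are
  within distance 1 of \<open>\<delta> a\<close>. Taking \<open>a\<close> or \<open>b\<close> to be
  0 also excludes codewords of weight 1.\<close>

lemma unit_vec_add_mem_imp_eq:
  assumes "a \<le> n" "b \<le> n" "\<delta> a + \<delta> b \<in> C"
  shows "a = b"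
  using ex1_neighbour[of "\<delta> a"] assms zero_mem vec_add_self[of "\<delta> a"] by (metis unit_vec_in_vectors)

lemma weight3_sum:
  assumes "l \<noteq> a" "l \<noteq> k" "a \<noteq> k" "l \<noteq> 0" "a \<noteq> 0" "k \<noteq> 0"
  shows "supp (\<delta> l + \<delta> a + \<delta> k) = {l, a, k}"
  using supp_unit_vec_sum[of "{l, a, k}"] assms by (simp add: add.assoc)

lemma weight3_eq:
  assumes "l \<noteq> a" "l \<noteq> k" "a \<noteq> k" "l \<noteq> 0" "a \<noteq> 0" "k \<noteq> 0" "supp x = {l, a, k}"
  shows "x = \<delta> l + \<delta> a + \<delta> k"
  using weight3_sum[OF assms(1-6)] assms(7) by (intro vec_eqI_supp) simp

text \<open>This removes the \<open>THE\<close> and the case distinction from the loop: since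
  \<open>\<delta> 0 = 0\<close>, the degenerate products satisfy the same membership condition as
  the triples. The condition is symmetric in the three arguments, and the loop laws below are read
  off from that symmetry.\<close>

lemma steiner_loop_eq_iff:
  assumes i: "i \<le> n" and j: "j \<le> n" and k: "k \<le> n"
  shows "steiner_loop C i j = k \<longleftrightarrow> \<delta> i + \<delta> j + \<delta> k \<in> C"
proof -
  have "\<exists>!k. k \<le> n \<and> \<delta> i + \<delta> j + \<delta> k \<in> C"
    using i j by (intro ex1_neighbour add_in_vectors unit_vec_in_vectors)
  then obtain h where h: "h \<le> n" "\<delta> i + \<delta> j + \<delta> h \<in> C"
    and uniq: "\<And>h'. h' \<le> n \<Longrightarrow> \<delta> i + \<delta> j + \<delta> h' \<in> C \<Longrightarrow> h' = h"
    by metis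
  have "steiner_loop C i j = h"
  proof (cases "i = 0 \<or> j = 0 \<or> i = j")
    case True
    then show ?thesis
      using uniq[of i] uniq[of j] uniq[of 0] i j zero_mem
      by (auto simp: steiner_loop_def vec_simps)
  next
    case False
    have "h \<noteq> 0"
      using unit_vec_add_mem_imp_eq[of i j] h i j False by (intro notI) simp
    moreover have "h \<noteq> i" "h \<noteq> j"
      using unit_vec_add_mem_imp_eq[of j 0]
        unit_vec_add_mem_imp_eq[of i 0] h i j False by (auto simp: vec_simps)
    ultimately have distinct: "h \<noteq> 0" "h \<noteq> i" "h \<noteq> j" "i \<noteq> 0" "j \<noteq> 0" "i \<noteq> j"
      using False by auto
    have "(THE k. {i, j, k} \<in> STS C) = h"
    proof (rule the_equality)
      have "supp (\<delta> i + \<delta> j + \<delta> h) = {i, j, h}"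
        using distinct by (intro weight3_sum) auto
      moreover have "card {i, j, h} = 3"
        using distinct by simp
      ultimately show "{i, j, h} \<in> STS C"
        using h unfolding STS_def by (auto intro!: exI[of _ "\<delta> i + \<delta> j + \<delta> h"])
    next
      fix h' assume "{i, j, h'} \<in> STS C"
      then obtain x where x: "{i, j, h'} = supp x" "x \<in> C" "card {i, j, h'} = 3"
        by (auto simp: STS_def)
      have "h' \<noteq> i" "h' \<noteq> j"
        using x(3) False by (auto simp: card_insert_if)
      moreover have "h' \<in> {1..n}"
        using x(1) supp_codeword[OF x(2)] by auto
      ultimately have "x = \<delta> i + \<delta> j + \<delta> h'"
        using x(1) False by (intro weight3_eq) auto
      then show "h' = h"
        using x(2) uniq \<open>h' \<in> {1..n}\<close> by auto
    qed
    with False show ?thesis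
      by (simp add: steiner_loop_def)
  qed
  with h uniq k show ?thesis by metis
qed

lemma steiner_loop_le: "i \<le> n \<Longrightarrow> j \<le> n \<Longrightarrow> steiner_loop C i j \<le> n"
  using ex1_neighbour[of "\<delta> i + \<delta> j"] steiner_loop_eq_iff
  by (metis add_in_vectors unit_vec_in_vectors)

lemma steiner_loop_mem: "i \<le> n \<Longrightarrow> j \<le> n \<Longrightarrow> \<delta> i + \<delta> j + \<delta> (steiner_loop C i j) \<in> C"
  using steiner_loop_eq_iff steiner_loop_le by blast

lemma steiner_loop_commute: "i \<le> n \<Longrightarrow> j \<le> n \<Longrightarrow> steiner_loop C i j = steiner_loop C j i"
  using steiner_loop_mem[of j i] by (subst steiner_loop_eq_iff) (auto simp: steiner_loop_le add.commute)

lemma steiner_loop_cancel: "i \<le> n \<Longrightarrow> j \<le> n \<Longrightarrow> steiner_loop C (steiner_loop C i j) j = i"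
  using steiner_loop_mem[of i j] by (subst steiner_loop_eq_iff) (auto simp: steiner_loop_le vec_simps)

lemma steiner_loop_0 [simp]: "steiner_loop C i 0 = i" "steiner_loop C 0 i = i" "steiner_loop C i i = 0"
  by (simp_all add: steiner_loop_def)

subsection \<open>The kernel\<close>

abbreviation Ker where "Ker \<equiv> kernel_code C"

text \<open>Inclusion suffices because adding \<open>x\<close> twice is the identity, so the
  translation is onto as soon as it maps \<open>C\<close> into itself.\<close>

lemma mem_Ker_iff: "x \<in> Ker \<longleftrightarrow> (\<forall>y \<in> C. x + y \<in> C)"
proof
  assume "x \<in> Ker"
  then show "\<forall>y \<in> C. x + y \<in> C"
    unfolding kernel_code_def by blast
next
  assume *: "\<forall>y \<in> C. x + y \<in> C"
  then have "x \<in> C"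
    using zero_mem by (metis add_0_right)
  moreover have "C \<subseteq> (\<lambda>y. x + y) ` C"
  proof
    fix y assume "y \<in> C"
    with * have "x + y \<in> C" by blast
    moreover have "y = x + (x + y)" by (simp add: vec_add_cancel)
    ultimately show "y \<in> (\<lambda>y. x + y) ` C" by blast
  qed
  ultimately show "x \<in> Ker"
    using * by (auto simp: kernel_code_def)
qed

lemma Ker_subset: "x \<in> Ker \<Longrightarrow> x \<in> C"
  by (simp add: kernel_code_def)

lemma zero_in_Ker [simp]: "0 \<in> Ker"
  by (simp add: mem_Ker_iff)

lemma Ker_add: "x \<in> Ker \<Longrightarrow> y \<in> Ker \<Longrightarrow> x + y \<in> Ker"
  by (simp add: mem_Ker_iff add.assoc)

lemma Ker_sum: "(\<And>x. x \<in> S \<Longrightarrow> f x \<in> Ker) \<Longrightarrow> (\<Sum>x\<in>S. f x) \<in> Ker"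
  by (induction S rule: infinite_finite_induct) (auto intro: Ker_add)

lemma unit_vec_add_Ker_imp_eq: "a \<le> n \<Longrightarrow> b \<le> n \<Longrightarrow> \<delta> a + \<delta> b \<in> Ker \<Longrightarrow> a = b"
  using Ker_subset unit_vec_add_mem_imp_eq by blast

text \<open>This is \<open>Lin_mu\<close> with the loop identity 0 adjoined, and with the counting
  condition replaced by one that can be used in sums. The identity is included so that the set is
  closed under the loop operation.\<close>

definition lin_elems :: "nat set" where
  "lin_elems = {l. l \<le> n \<and> (\<forall>s \<le> n. \<delta> l + \<delta> s + \<delta> (steiner_loop C l s) \<in> Ker)}"

lemma lin_elems_le: "l \<in> lin_elems \<Longrightarrow> l \<le> n"
  by (simp add: lin_elems_def)

lemma lin_elems_Ker: "l \<in> lin_elems \<Longrightarrow> s \<le> n \<Longrightarrow> \<delta> l + \<delta> s + \<delta> (steiner_loop C l s) \<in> Ker"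
  by (simp add: lin_elems_def)

lemma zero_in_lin_elems [simp]: "0 \<in> lin_elems"
  by (simp add: lin_elems_def vec_simps)

lemma lin_elemsI:
  assumes "l \<le> n" "\<And>s. s \<le> n \<Longrightarrow> \<exists>k \<le> n. \<delta> l + \<delta> s + \<delta> k \<in> Ker"
  shows "l \<in> lin_elems"
  unfolding lin_elems_def using assms Ker_subset steiner_loop_eq_iff by blast

text \<open>Deleting \<open>l\<close> from the triples through \<open>l\<close> partitions the
  remaining \<open>n - 1\<close> points into pairs. This is the origin of the maximal value in
  \<open>Lin_mu\<close>.\<close>

lemma card_triples_through:
  assumes l: "l \<in> {1..n}"
  shows "2 * card {x \<in> C. card (supp x) = 3 \<and> l \<in> supp x} = n - 1"
    (is "2 * card ?X = _")
proof -
  let ?F = "(\<lambda>x. supp x - {l}) ` ?X"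
  \<comment> \<open>Two points determine the triple, so pairs coming from different codewords are
    disjoint.\<close>
  have third: "x = \<delta> l + \<delta> a + \<delta> (steiner_loop C l a)"
    if "x \<in> ?X" "a \<in> supp x" "a \<noteq> l" for x a
  proof -
    have "card (supp x - {l}) = 2" "a \<in> supp x - {l}"
      using that by simp_all
    then obtain k where k: "supp x - {l} = {a, k}" "k \<noteq> a"
      using card_2_other by metis
    then have "supp x = {l, a, k}" "k \<noteq> l"
      using that by auto
    moreover from this have "{l, a, k} \<subseteq> {1..n}"
      using supp_codeword[of x] that by simp
    ultimately have "x = \<delta> l + \<delta> a + \<delta> k"
      using that k by (intro weight3_eq) auto
    then show ?thesis
      using steiner_loop_eq_iff[of l a k] that \<open>{l, a, k} \<subseteq> {1..n}\<close> by auto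
  qed
  have "2 * card ?F = card (\<Union> ?F)"
  proof (rule card_partition)
    show "finite ?F" using finite_code by simp
    show "finite (\<Union> ?F)"
      by (rule finite_subset[of _ "{1..n}"]) (use supp_codeword in auto)
    show "card c = 2" if "c \<in> ?F" for c
      using that by auto
    show "c1 \<inter> c2 = {}" if "c1 \<in> ?F" "c2 \<in> ?F" "c1 \<noteq> c2" for c1 c2
    proof (rule ccontr)
      assume "c1 \<inter> c2 \<noteq> {}"
      then obtain a x1 x2 where "x1 \<in> ?X" "c1 = supp x1 - {l}" "x2 \<in> ?X" "c2 = supp x2 - {l}"
        "a \<in> supp x1" "a \<in> supp x2" "a \<noteq> l"
        using \<open>c1 \<in> ?F\<close> \<open>c2 \<in> ?F\<close> by blast
      then show False
        using third[of x1 a] third[of x2 a] \<open>c1 \<noteq> c2\<close> by metis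
    qed
  qed
  moreover have "card ?F = card ?X"
  proof (rule card_image, rule inj_onI)
    fix x y assume "x \<in> ?X" "y \<in> ?X" "supp x - {l} = supp y - {l}"
    then show "x = y"
      by (intro vec_eqI_supp) auto
  qed
  moreover have "\<Union> ?F = {1..n} - {l}"
  proof
    show "\<Union> ?F \<subseteq> {1..n} - {l}"
      using supp_codeword by auto
    show "{1..n} - {l} \<subseteq> \<Union> ?F"
    proof
      fix s assume s: "s \<in> {1..n} - {l}"
      define k where "k = steiner_loop C l s"
      have k: "\<delta> l + \<delta> s + \<delta> k \<in> C" "k \<le> n"
        using s l by (simp_all add: k_def steiner_loop_mem steiner_loop_le)
      have "k \<noteq> 0"
        using unit_vec_add_mem_imp_eq[of l s] k s l by (intro notI) auto
      moreover have "k \<noteq> l" "k \<noteq> s"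
        using unit_vec_add_mem_imp_eq[of s 0]
          unit_vec_add_mem_imp_eq[of l 0] k s l by (auto simp: vec_simps)
      ultimately have distinct: "l \<noteq> s" "l \<noteq> k" "s \<noteq> k" "l \<noteq> 0" "s \<noteq> 0" "k \<noteq> 0"
        using s l by auto
      then have "supp (\<delta> l + \<delta> s + \<delta> k) = {l, s, k}" "card {l, s, k} = 3"
        using weight3_sum[OF distinct] by simp_all
      then show "s \<in> \<Union> ?F"
        using k s by (auto intro!: bexI[of _ "\<delta> l + \<delta> s + \<delta> k"])
    qed
  qed
  ultimately show ?thesis
    using l by simp
qed

text \<open>The triples in the kernel are among all triples through \<open>l\<close>, whose number
  is the maximal value; the counts agree exactly when every triple through \<open>l\<close> lies in
  the kernel.\<close>

lemma Lin_mu_eq: "Lin_mu n C = lin_elems - {0}"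
proof -
  have "l \<in> Lin_mu n C \<longleftrightarrow> l \<in> lin_elems" if l: "l \<in> {1..n}" for l
  proof -
    let ?X = "{x \<in> C. card (supp x) = 3 \<and> l \<in> supp x}"
    let ?Y = "{x \<in> Ker. card (supp x) = 3 \<and> l \<in> supp x}"
    have YX: "?Y \<subseteq> ?X"
      using Ker_subset by blast
    have "l \<in> Lin_mu n C \<longleftrightarrow> 2 * card ?Y = n - 1"
      using l length_ge by (auto simp: Lin_mu_def mu_def field_simps of_nat_diff)
    also have "\<dots> \<longleftrightarrow> card ?Y = card ?X"
      using card_triples_through[OF l] by linarith
    also have "\<dots> \<longleftrightarrow> ?Y = ?X"
      using card_subset_eq[of ?X ?Y] YX finite_code by auto
    also have "\<dots> \<longleftrightarrow> l \<in> lin_elems"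
    proof
      assume eq: "?Y = ?X"
      show "l \<in> lin_elems"
      proof (rule lin_elemsI)
        fix s assume "s \<le> n"
        define k where "k = steiner_loop C l s"
        have k: "\<delta> l + \<delta> s + \<delta> k \<in> C" "k \<le> n"
          using \<open>s \<le> n\<close> l by (simp_all add: k_def steiner_loop_mem steiner_loop_le)
        have "\<delta> l + \<delta> s + \<delta> k \<in> Ker"
        proof (cases "s = 0 \<or> s = l")
          case True
          then show ?thesis by (auto simp: k_def vec_simps)
        next
          case False
          have "k \<noteq> 0"
            using unit_vec_add_mem_imp_eq[of l s] k \<open>s \<le> n\<close> l False by (intro notI) auto
          moreover have "k \<noteq> l" "k \<noteq> s"
            using False unit_vec_add_mem_imp_eq[of s 0]
              unit_vec_add_mem_imp_eq[of l 0] k \<open>s \<le> n\<close> l by (auto simp: vec_simps)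
          ultimately have distinct: "l \<noteq> s" "l \<noteq> k" "s \<noteq> k" "l \<noteq> 0" "s \<noteq> 0" "k \<noteq> 0"
            using False l by auto
          then have "supp (\<delta> l + \<delta> s + \<delta> k) = {l, s, k}" "card {l, s, k} = 3"
            using weight3_sum[OF distinct] by simp_all
          then have "\<delta> l + \<delta> s + \<delta> k \<in> ?X"
            using k by simp
          with eq show ?thesis by blast
        qed
        then show "\<exists>k \<le> n. \<delta> l + \<delta> s + \<delta> k \<in> Ker"
          using k by blast
      qed (use l in simp)
    next
      assume lin: "l \<in> lin_elems"
      have "x \<in> Ker" if x: "x \<in> ?X" for x
      proof -
        have "card (supp x - {l}) = 2"
          using x by simp
        then obtain a k where ak: "supp x - {l} = {a, k}" "a \<noteq> k"
          by (auto simp: card_2_iff)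
        then have supp: "supp x = {l, a, k}" "l \<noteq> a" "l \<noteq> k"
          using x by auto
        moreover from this have le: "{l, a, k} \<subseteq> {1..n}"
          using supp_codeword[of x] x by simp
        ultimately have "x = \<delta> l + \<delta> a + \<delta> k"
          using ak by (intro weight3_eq) auto
        then show ?thesis
          using steiner_loop_eq_iff[of l a k] x le lin_elems_Ker[OF lin, of a] by auto
      qed
      then show "?Y = ?X"
        using YX by blast
    qed
    finally show ?thesis .
  qed
  moreover have "Lin_mu n C \<subseteq> {1..n}" "lin_elems - {0} \<subseteq> {1..n}"
    using lin_elems_le by (auto simp: Lin_mu_def Suc_le_eq)
  ultimately show ?thesis
    by auto
qed

end

section \<open>Coordinate permutations\<close>

lemma supp_perm_vec: "bij p \<Longrightarrow> supp (perm_vec p x) = p ` supp x"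
  by (simp add: supp_def perm_vec_def bij_image_Collect_eq)

lemma perm_vec_id [simp]: "perm_vec id x = x"
  by (simp add: perm_vec_def)

lemma perm_vec_comp: "bij p \<Longrightarrow> bij q \<Longrightarrow> perm_vec (p \<circ> q) x = perm_vec p (perm_vec q x)"
  by (rule vec_eqI_supp) (simp add: supp_perm_vec bij_comp image_comp)

lemma inj_perm_vec: "bij p \<Longrightarrow> inj (perm_vec p)"
  by (rule injI) (metis bij_imp_bij_inv bij_is_inj inv_o_cancel perm_vec_comp perm_vec_id)

lemma perm_vec_unit_sum:
  assumes "p permutes {1..n}"
  shows "perm_vec p (\<Sum>x\<in>S. \<delta> (f x)) = (\<Sum>x\<in>S. \<delta> (p (f x)))"
proof -
  have "p 0 = 0"
    using permutes_not_in[OF assms, of 0] by simp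
  then have "\<delta> k (inv_into UNIV p i) = \<delta> (p k) i" for k i
    using permutes_inverses[OF assms] permutes_inj[OF assms] unfolding unit_vec_def
    by (metis inj_def)
  then show ?thesis
    by (intro ext) (simp add: perm_vec_def sum_fun_apply)
qed

text \<open>An injective map of a finite code into itself is onto, so only one inclusion has to be
  checked.\<close>

lemma Sym_code_iff:
  assumes "finite C"
  shows "p \<in> Sym_code I C \<longleftrightarrow> p permutes I \<and> (\<forall>x \<in> C. perm_vec p x \<in> C)"
proof
  assume *: "p permutes I \<and> (\<forall>x \<in> C. perm_vec p x \<in> C)"
  then have "perm_vec p ` C = C"
    using assms inj_perm_vec[OF permutes_bij] by (intro endo_inj_surj) (auto intro: inj_on_subset)
  with * show "p \<in> Sym_code I C" by (simp add: Sym_code_def)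
qed (auto simp: Sym_code_def)

lemma group_perm_group: "group (perm_group I)"
proof (rule groupI)
  fix p assume "p \<in> carrier (perm_group I)"
  then show "\<exists>q \<in> carrier (perm_group I). q \<otimes>\<^bsub>perm_group I\<^esub> p = \<one>\<^bsub>perm_group I\<^esub>"
    by (auto simp: perm_group_def intro!: bexI[of _ "inv_into UNIV p"] permutes_inv permutes_inv_o)
qed (auto simp: perm_group_def o_assoc permutes_compose)

lemma mult_perm_group [simp]: "p \<otimes>\<^bsub>perm_group I\<^esub> q = p \<circ> q"
  by (simp add: perm_group_def)

lemma one_perm_group [simp]: "\<one>\<^bsub>perm_group I\<^esub> = id"
  by (simp add: perm_group_def)

lemma carrier_perm_group [simp]: "p \<in> carrier (perm_group I) \<longleftrightarrow> p permutes I"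
  by (simp add: perm_group_def)

lemma inv_perm_group:
  assumes "p permutes I"
  shows "inv\<^bsub>perm_group I\<^esub> p = inv_into UNIV p"
  using assms by (intro group.inv_equality[OF group_perm_group]) (simp_all add: permutes_inv permutes_inv_o)

lemma subgroup_perm_groupI:
  assumes "\<And>p. p \<in> H \<Longrightarrow> p permutes I" "id \<in> H"
    "\<And>p q. p \<in> H \<Longrightarrow> q \<in> H \<Longrightarrow> p \<circ> q \<in> H" "\<And>p. p \<in> H \<Longrightarrow> inv_into UNIV p \<in> H"
  shows "subgroup H (perm_group I)"
  by standard (use assms in \<open>auto simp: inv_perm_group\<close>)

lemma subgroup_Sym_code: "subgroup (Sym_code I C) (perm_group I)"
proof (rule subgroup_perm_groupI)
  show "p permutes I" if "p \<in> Sym_code I C" for p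
    using that by (simp add: Sym_code_def)
  show "id \<in> Sym_code I C"
    by (simp add: Sym_code_def permutes_id)
  show "p \<circ> q \<in> Sym_code I C" if "p \<in> Sym_code I C" "q \<in> Sym_code I C" for p q
  proof -
    have "perm_vec (p \<circ> q) ` C = perm_vec p ` perm_vec q ` C"
      unfolding image_image using that
      by (intro image_cong refl perm_vec_comp) (auto simp: Sym_code_def intro: permutes_bij)
    with that show ?thesis
      by (simp add: Sym_code_def permutes_compose)
  qed
  show "inv_into UNIV p \<in> Sym_code I C" if "p \<in> Sym_code I C" for p
  proof -
    have p: "p permutes I" "perm_vec p ` C = C"
      using that by (simp_all add: Sym_code_def)
    have "perm_vec (inv_into UNIV p) (perm_vec p x) = x" for x
      using perm_vec_comp[of "inv_into UNIV p" p x] permutes_inv_o[OF p(1)] permutes_bij[OF p(1)]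
      by (simp add: bij_imp_bij_inv)
    then have "perm_vec (inv_into UNIV p) ` perm_vec p ` C = C"
      by (simp add: image_image)
    with p show ?thesis
      by (simp add: Sym_code_def permutes_inv)
  qed
qed

lemma Stab_Sym_eq: "Stab_Sym I E M = Sym_code I M \<inter> Sym_code I E"
  by (auto simp: Stab_Sym_def Sym_code_def)

lemma subgroup_Stab_Sym: "subgroup (Stab_Sym I E M) (perm_group I)"
  unfolding Stab_Sym_eq
  using group.subgroups_Inter_pair[OF group_perm_group subgroup_Sym_code subgroup_Sym_code] .

lemma permutesI_inverse:
  assumes "\<And>x. x \<notin> I \<Longrightarrow> p x = x" "p \<circ> q = id" "q \<circ> p = id"
  shows "p permutes I"
  unfolding permutes_def using assms(1) o_bij[OF assms(3,2)] by (auto simp: bij_iff)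

section \<open>The stabilizer as a group of permutations of codeword supports\<close>

locale mollard_pair =
  C: perfect_code0 t C + D: perfect_code0 m D for t C m D
begin

abbreviation "coords \<equiv> mollard_coords t m"

abbreviation "stab \<equiv> Stab_Sym coords (embed2 m ` D) (mollard t m C D)"

lemma mem_coords_iff: "(r, s) \<in> coords \<longleftrightarrow> r \<le> t \<and> s \<le> m \<and> (r, s) \<noteq> (0, 0)"
  by (auto simp: mollard_coords_def)

lemma finite_coords: "finite coords"
  by (simp add: mollard_coords_def)

section \<open>Parities as sums over supports, and the stabilizer in terms of supports\<close>

lemma sum_supp_box:
  assumes "z \<in> vectors coords"
  shows "(\<Sum>q\<in>supp z. f q :: bit) = (\<Sum>r=0..t. \<Sum>s=0..m. z (r, s) * f (r, s))"
proof -
  have "supp z \<subseteq> {0..t} \<times> {0..m}"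
    using supp_subset[OF assms] by (auto simp: mollard_coords_def)
  then have "(\<Sum>q\<in>supp z. z q * f q) = (\<Sum>q\<in>{0..t} \<times> {0..m}. z q * f q)"
    by (intro sum.mono_neutral_left) (auto simp: supp_def)
  moreover have "(\<Sum>q\<in>supp z. z q * f q) = (\<Sum>q\<in>supp z. f q)"
    by (intro sum.cong) (auto simp: supp_def)
  ultimately show ?thesis
    by (simp del: mult_bit_eq_and add: sum.cartesian_product)
qed

lemma parity1_eq:
  assumes "z \<in> vectors coords"
  shows "parity1 t m z = (\<Sum>q\<in>supp z. \<delta> (fst q))"
proof (rule ext)
  fix i
  have "(\<Sum>q\<in>supp z. \<delta> (fst q)) i = (\<Sum>r=0..t. \<Sum>s=0..m. z (r, s) * \<delta> r i)"
    by (simp add: sum_fun_apply sum_supp_box[OF assms] del: mult_bit_eq_and)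
  also have "\<dots> = (\<Sum>r=0..t. if r = i then (if i \<noteq> 0 then \<Sum>s=0..m. z (i, s) else 0) else 0)"
    by (intro sum.cong refl) (auto simp: unit_vec_def simp del: mult_bit_eq_and)
  also have "\<dots> = parity1 t m z i"
    by (auto simp: parity1_def simp del: mult_bit_eq_and)
  finally show "parity1 t m z i = (\<Sum>q\<in>supp z. \<delta> (fst q)) i" ..
qed

lemma parity2_eq:
  assumes "z \<in> vectors coords"
  shows "parity2 t m z = (\<Sum>q\<in>supp z. \<delta> (snd q))"
proof (rule ext)
  fix i
  have "(\<Sum>q\<in>supp z. \<delta> (snd q)) i = (\<Sum>r=0..t. \<Sum>s=0..m. z (r, s) * \<delta> s i)"
    by (simp add: sum_fun_apply sum_supp_box[OF assms] del: mult_bit_eq_and)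
  also have "\<dots> = (\<Sum>s=0..m. \<Sum>r=0..t. z (r, s) * \<delta> s i)"
    by (rule sum.swap)
  also have "\<dots> = (\<Sum>s=0..m. if s = i then (if i \<noteq> 0 then \<Sum>r=0..t. z (r, i) else 0) else 0)"
    by (intro sum.cong refl) (auto simp: unit_vec_def simp del: mult_bit_eq_and)
  also have "\<dots> = parity2 t m z i"
    by (auto simp: parity2_def simp del: mult_bit_eq_and)
  finally show "parity2 t m z i = (\<Sum>q\<in>supp z. \<delta> (snd q)) i" ..
qed

text \<open>These are the supports of the Mollard codewords. Row 0 and column 0 drop out of the two
  sums through \<open>\<delta> 0 = 0\<close>, as they do from the parities; on supports a
  permutation acts simply by taking images.\<close>

definition blocks :: "(nat \<times> nat) set set" where
  "blocks = {S. S \<subseteq> coords \<and> (\<Sum>q\<in>S. \<delta> (fst q)) \<in> C \<and> (\<Sum>q\<in>S. \<delta> (snd q)) \<in> D}"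

lemma mem_mollard_iff: "z \<in> mollard t m C D \<longleftrightarrow> supp z \<in> blocks"
proof -
  have "z \<in> vectors coords \<longleftrightarrow> supp z \<subseteq> coords"
    unfolding vectors_def supp_def by blast
  then show ?thesis
    by (auto simp: mollard_def blocks_def parity1_eq parity2_eq)
qed

lemma finite_mollard: "finite (mollard t m C D)"
proof (rule finite_imageD)
  show "finite (supp ` mollard t m C D)"
    by (rule finite_subset[of _ "Pow coords"])
      (use finite_coords in \<open>auto simp: mem_mollard_iff blocks_def\<close>)
  show "inj_on supp (mollard t m C D)"
    by (auto intro!: inj_onI vec_eqI_supp)
qed

lemma blocks_imp_codeword: "S \<in> blocks \<Longrightarrow> \<exists>z \<in> mollard t m C D. supp z = S"
  by (rule bexI[of _ "\<lambda>q. if q \<in> S then 1 else 0"]) (auto simp: mem_mollard_iff supp_def)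

lemma supp_embed2: "supp (embed2 m y) = {0} \<times> (supp y \<inter> {1..m})"
  by (auto simp: supp_def embed2_def split: if_splits)

lemma row0_eq: "{0} \<times> S = Pair 0 ` S"
  by auto

lemma sum_row0: "(\<Sum>q\<in>{0} \<times> S. f q) = (\<Sum>s\<in>S. f (0, s))"
  unfolding row0_eq by (simp add: sum.reindex inj_on_def)

text \<open>Inside row 0 the first parity vanishes and the second one is the word itself, so nothing
  but membership in \<open>D\<close> remains to be checked.\<close>

lemma embed2_image_iff:
  "z \<in> embed2 m ` D \<longleftrightarrow> z \<in> mollard t m C D \<and> supp z \<subseteq> {0} \<times> UNIV"
proof
  assume "z \<in> embed2 m ` D"
  then obtain y where y: "y \<in> D" "z = embed2 m y" by blast
  then have supp: "supp z = {0} \<times> supp y"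
    using D.supp_codeword[of y] supp_embed2[of y] by auto
  moreover have "finite (supp y)"
    using D.supp_codeword[OF y(1)] finite_subset by blast
  ultimately have "(\<Sum>q\<in>supp z. \<delta> (fst q)) = 0" "(\<Sum>q\<in>supp z. \<delta> (snd q)) = y"
    using vec_eq_sum[OF D.mem_vectors[OF y(1)]] by (simp_all add: sum_row0)
  then show "z \<in> mollard t m C D \<and> supp z \<subseteq> {0} \<times> UNIV"
    using supp y(1) D.supp_codeword[OF y(1)] C.zero_mem
    by (auto simp: mem_mollard_iff blocks_def mem_coords_iff)
next
  assume *: "z \<in> mollard t m C D \<and> supp z \<subseteq> {0} \<times> UNIV"
  define S where "S = snd ` supp z"
  have S: "supp z = {0} \<times> S"
    using * by (force simp: S_def)
  have S': "S \<subseteq> {1..m}"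
    using * S by (auto simp: mem_mollard_iff blocks_def subset_iff mem_coords_iff Suc_le_eq)
  then have fin: "finite S" "0 \<notin> S"
    using finite_subset by auto
  define y where "y = (\<Sum>k\<in>S. \<delta> k)"
  have "y \<in> D"
    using * S fin by (simp add: y_def mem_mollard_iff blocks_def sum_row0)
  moreover have "supp y = S"
    unfolding y_def using fin by (rule supp_unit_vec_sum)
  then have "z = embed2 m y"
    using S S' by (intro vec_eqI_supp) (auto simp: supp_embed2)
  ultimately show "z \<in> embed2 m ` D" by blast
qed

text \<open>It ensures that the supports of the embedded copy of \<open>D\<close> cover row 0, so
  that stabilizing this subcode forces row 0 to be preserved.\<close>

lemma coord_in_codeword:
  assumes "s \<in> {1..m}"
  shows "\<exists>y \<in> D. s \<in> supp y"
proof -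
  obtain a where a: "a \<in> {1..m}" "a \<noteq> s"
  proof (cases "s = 1")
    case True
    then show ?thesis using that[of 2] D.length_ge by simp
  next
    case False
    then show ?thesis using that[of 1] D.length_ge by simp
  qed
  define k where "k = steiner_loop D s a"
  have k: "k \<le> m" "\<delta> s + \<delta> a + \<delta> k \<in> D"
    using assms a by (simp_all add: k_def D.steiner_loop_le D.steiner_loop_mem)
  \<comment> \<open>If \<open>k = s\<close>, the codeword would be \<open>\<delta> a\<close>, of
    weight 1.\<close>
  moreover have "k \<noteq> s"
    using D.unit_vec_add_mem_imp_eq[of a 0] k a assms by (auto simp: vec_simps)
  ultimately show ?thesis
    using a assms by (auto intro!: bexI[of _ "\<delta> s + \<delta> a + \<delta> k"] simp: supp_def unit_vec_def)
qed

text \<open>The working description of the stabilizer. Preserving the subcode amounts to preserving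
  row 0, since its words cover row 0 and are exactly the codewords supported there. The quantifier
  over all \<open>s\<close> is harmless: a permutation of the coordinates fixes every
  \<open>(0, s)\<close> that is not a coordinate.\<close>

lemma mem_stab_iff:
  "\<sigma> \<in> stab \<longleftrightarrow> \<sigma> permutes coords \<and>
    (\<forall>S \<in> blocks. (\<Sum>q\<in>S. \<delta> (fst (\<sigma> q))) \<in> C \<and> (\<Sum>q\<in>S. \<delta> (snd (\<sigma> q))) \<in> D) \<and>
    (\<forall>s. fst (\<sigma> (0, s)) = 0)"
proof (cases "\<sigma> permutes coords")
  case True
  note bij = permutes_bij[OF True] and inj = permutes_inj[OF True]
  have "\<sigma> \<in> Sym_code coords (mollard t m C D) \<longleftrightarrow>
      (\<forall>z \<in> mollard t m C D. \<sigma> ` supp z \<in> blocks)"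
    using True by (simp add: Sym_code_iff[OF finite_mollard] mem_mollard_iff supp_perm_vec[OF bij])
  also have "\<dots> \<longleftrightarrow> (\<forall>S \<in> blocks. \<sigma> ` S \<in> blocks)"
    using blocks_imp_codeword by (metis mem_mollard_iff)
  also have "\<dots> \<longleftrightarrow> (\<forall>S \<in> blocks. (\<Sum>q\<in>S. \<delta> (fst (\<sigma> q))) \<in> C \<and> (\<Sum>q\<in>S. \<delta> (snd (\<sigma> q))) \<in> D)"
  proof (intro ball_cong refl)
    fix S assume "S \<in> blocks"
    then have "\<sigma> ` S \<subseteq> coords"
      using permutes_image[OF True] by (auto simp: blocks_def)
    then show "\<sigma> ` S \<in> blocks \<longleftrightarrow>
        (\<Sum>q\<in>S. \<delta> (fst (\<sigma> q))) \<in> C \<and> (\<Sum>q\<in>S. \<delta> (snd (\<sigma> q))) \<in> D"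
      by (simp add: blocks_def sum.reindex[OF inj_on_subset[OF inj subset_UNIV]])
  qed
  finally have 1: "\<sigma> \<in> Sym_code coords (mollard t m C D) \<longleftrightarrow>
    (\<forall>S \<in> blocks. (\<Sum>q\<in>S. \<delta> (fst (\<sigma> q))) \<in> C \<and> (\<Sum>q\<in>S. \<delta> (snd (\<sigma> q))) \<in> D)" .
  have 2: "\<sigma> \<in> Sym_code coords (embed2 m ` D) \<longleftrightarrow> (\<forall>s. fst (\<sigma> (0, s)) = 0)"
    if sym: "\<sigma> \<in> Sym_code coords (mollard t m C D)"
  proof
    assume stab: "\<sigma> \<in> Sym_code coords (embed2 m ` D)"
    show "\<forall>s. fst (\<sigma> (0, s)) = 0"
    proof
      fix s
      show "fst (\<sigma> (0, s)) = 0"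
      proof (cases "s \<in> {1..m}")
        case True
        then obtain y where y: "y \<in> D" "s \<in> supp y"
          using coord_in_codeword by blast
        then have "perm_vec \<sigma> (embed2 m y) \<in> embed2 m ` D"
          using stab D.finite_code by (simp add: Sym_code_iff)
        then have "\<sigma> ` supp (embed2 m y) \<subseteq> {0} \<times> UNIV"
          by (simp add: embed2_image_iff supp_perm_vec[OF bij])
        moreover have "(0, s) \<in> supp (embed2 m y)"
          using y True by (simp add: supp_embed2)
        ultimately show ?thesis by auto
      next
        case False
        then have "(0, s) \<notin> coords"
          by (auto simp: mem_coords_iff)
        then show ?thesis
          using permutes_not_in[OF \<open>\<sigma> permutes coords\<close>] by simp
      qed
    qed
  next
    assume row: "\<forall>s. fst (\<sigma> (0, s)) = 0"
    have "perm_vec \<sigma> z \<in> embed2 m ` D" if "z \<in> embed2 m ` D" for z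
    proof -
      have "perm_vec \<sigma> z \<in> mollard t m C D"
        using that sym by (auto simp: embed2_image_iff Sym_code_iff[OF finite_mollard])
      moreover have "fst (\<sigma> q) = 0" if "q \<in> supp z" for q
        using row \<open>z \<in> embed2 m ` D\<close> that by (cases q) (auto simp: embed2_image_iff)
      then have "\<sigma> ` supp z \<subseteq> {0} \<times> UNIV"
        by (metis UNIV_I image_subsetI mem_Times_iff singletonI)
      ultimately show ?thesis
        by (simp add: embed2_image_iff supp_perm_vec[OF bij])
    qed
    then show "\<sigma> \<in> Sym_code coords (embed2 m ` D)"
      using True D.finite_code by (simp add: Sym_code_iff)
  qed
  show ?thesis
    unfolding Stab_Sym_eq using 1 2 True by blast
next
  case False
  then show ?thesis
    by (simp add: Stab_Sym_def Sym_code_def)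
qed

section \<open>Closure properties of the stabilizer\<close>

abbreviation "P \<equiv> perm_group coords"

lemma stab_permutes: "\<sigma> \<in> stab \<Longrightarrow> \<sigma> permutes coords"
  by (simp add: mem_stab_iff)

lemma stab_blocks:
  assumes "\<sigma> \<in> stab" "S \<subseteq> coords" "(\<Sum>q\<in>S. \<delta> (fst q)) \<in> C" "(\<Sum>q\<in>S. \<delta> (snd q)) \<in> D"
  shows "(\<Sum>q\<in>S. \<delta> (fst (\<sigma> q))) \<in> C" "(\<Sum>q\<in>S. \<delta> (snd (\<sigma> q))) \<in> D"
  using assms unfolding mem_stab_iff blocks_def by blast+

lemma stab_comp: "\<sigma> \<in> stab \<Longrightarrow> \<tau> \<in> stab \<Longrightarrow> \<sigma> \<circ> \<tau> \<in> stab"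
  using subgroup.m_closed[OF subgroup_Stab_Sym, of \<sigma> coords "embed2 m ` D" "mollard t m C D" \<tau>] by simp

lemma stab_inv: "\<sigma> \<in> stab \<Longrightarrow> inv_into UNIV \<sigma> \<in> stab"
  using subgroup.m_inv_closed[OF subgroup_Stab_Sym, of \<sigma> coords "embed2 m ` D" "mollard t m C D"]
  by (simp add: inv_perm_group stab_permutes)

lemma block_cases: "S \<in> blocks \<Longrightarrow> finite S \<and> (\<forall>(r, s) \<in> S. r \<le> t \<and> s \<le> m)"
  using finite_subset[OF _ finite_coords] by (auto simp: blocks_def subset_iff mem_coords_iff)

subsection \<open>The images of the two symmetry groups\<close>

lemma Dub1_comp:
  assumes "q permutes {1..t}"
  shows "Dub1 m (p \<circ> q) = Dub1 m p \<circ> Dub1 m q"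
proof -
  have "q r \<noteq> 0" if "r \<noteq> 0" for r
    using permutes_not_in[OF assms, of 0] permutes_inj[OF assms] that by (metis inj_eq atLeastAtMost_iff not_one_le_zero)
  then show ?thesis
    by (auto simp: Dub1_def fun_eq_iff)
qed

lemma Dub1_id [simp]: "Dub1 m id = id"
  by (auto simp: Dub1_def fun_eq_iff)

lemma Dub1_permutes:
  assumes "p permutes {1..t}"
  shows "Dub1 m p permutes coords"
proof (rule permutesI_inverse[where q = "Dub1 m (inv_into UNIV p)"])
  show "Dub1 m p \<circ> Dub1 m (inv_into UNIV p) = id" "Dub1 m (inv_into UNIV p) \<circ> Dub1 m p = id"
    using assms by (simp_all add: Dub1_comp[symmetric] permutes_inv permutes_inv_o)
  show "Dub1 m p x = x" if "x \<notin> coords" for x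
    using that permutes_not_in[OF assms] by (cases x) (auto simp: Dub1_def mem_coords_iff)
qed

lemma inv_Dub1: "p permutes {1..t} \<Longrightarrow> inv_into UNIV (Dub1 m p) = Dub1 m (inv_into UNIV p)"
  by (rule inv_unique_comp) (simp_all add: Dub1_comp[symmetric] permutes_inv permutes_inv_o)

text \<open>Permuting row indices applies \<open>p\<close> to the first parity and leaves the second
  unchanged.\<close>

lemma Dub1_stab:
  assumes "p \<in> Sym_code {1..t} C"
  shows "Dub1 m p \<in> stab"
proof -
  have p: "p permutes {1..t}" "\<And>x. x \<in> C \<Longrightarrow> perm_vec p x \<in> C"
    using assms C.finite_code by (simp_all add: Sym_code_iff)
  have p0: "p 0 = 0"
    using permutes_not_in[OF p(1), of 0] by simp
  have "(\<Sum>q\<in>S. \<delta> (fst (Dub1 m p q))) \<in> C \<and> (\<Sum>q\<in>S. \<delta> (snd (Dub1 m p q))) \<in> D"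
    if "S \<in> blocks" for S
  proof -
    have "Dub1 m p q = (p (fst q), snd q)" if "q \<in> S" for q
      using block_cases[OF \<open>S \<in> blocks\<close>] that p0 by (cases q) (auto simp: Dub1_def)
    then show ?thesis
      using that p(2)[of "\<Sum>q\<in>S. \<delta> (fst q)"] by (simp add: perm_vec_unit_sum[OF p(1)] blocks_def)
  qed
  then show ?thesis
    using Dub1_permutes[OF p(1)] by (simp add: mem_stab_iff Dub1_def)
qed

lemma Dub2_comp:
  assumes "q permutes {1..m}"
  shows "Dub2 t (p \<circ> q) = Dub2 t p \<circ> Dub2 t q"
proof -
  have "q r \<noteq> 0" if "r \<noteq> 0" for r
    using permutes_not_in[OF assms, of 0] permutes_inj[OF assms] that by (metis inj_eq atLeastAtMost_iff not_one_le_zero)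
  then show ?thesis
    by (auto simp: Dub2_def fun_eq_iff)
qed

lemma Dub2_id [simp]: "Dub2 t id = id"
  by (auto simp: Dub2_def fun_eq_iff)

lemma Dub2_permutes:
  assumes "p permutes {1..m}"
  shows "Dub2 t p permutes coords"
proof (rule permutesI_inverse[where q = "Dub2 t (inv_into UNIV p)"])
  show "Dub2 t p \<circ> Dub2 t (inv_into UNIV p) = id" "Dub2 t (inv_into UNIV p) \<circ> Dub2 t p = id"
    using assms by (simp_all add: Dub2_comp[symmetric] permutes_inv permutes_inv_o)
  show "Dub2 t p x = x" if "x \<notin> coords" for x
    using that permutes_not_in[OF assms] by (cases x) (auto simp: Dub2_def mem_coords_iff)
qed

lemma inv_Dub2: "p permutes {1..m} \<Longrightarrow> inv_into UNIV (Dub2 t p) = Dub2 t (inv_into UNIV p)"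
  by (rule inv_unique_comp) (simp_all add: Dub2_comp[symmetric] permutes_inv permutes_inv_o)

lemma Dub2_stab:
  assumes "p \<in> Sym_code {1..m} D"
  shows "Dub2 t p \<in> stab"
proof -
  have p: "p permutes {1..m}" "\<And>x. x \<in> D \<Longrightarrow> perm_vec p x \<in> D"
    using assms D.finite_code by (simp_all add: Sym_code_iff)
  have p0: "p 0 = 0"
    using permutes_not_in[OF p(1), of 0] by simp
  have "(\<Sum>q\<in>S. \<delta> (fst (Dub2 t p q))) \<in> C \<and> (\<Sum>q\<in>S. \<delta> (snd (Dub2 t p q))) \<in> D"
    if "S \<in> blocks" for S
  proof -
    have "Dub2 t p q = (fst q, p (snd q))" if "q \<in> S" for q
      using block_cases[OF \<open>S \<in> blocks\<close>] that p0 by (cases q) (auto simp: Dub2_def)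
    then show ?thesis
      using that p(2)[of "\<Sum>q\<in>S. \<delta> (snd q)"] by (simp add: perm_vec_unit_sum[OF p(1)] blocks_def)
  qed
  then show ?thesis
    using Dub2_permutes[OF p(1)] by (simp add: mem_stab_iff Dub2_def)
qed

lemma subgroup_Dub1: "subgroup (Dub1 m ` Sym_code {1..t} C) P"
proof (rule subgroup_perm_groupI)
  note Sym = subgroup_Sym_code[of "{1..t}" C]
  show "a permutes coords" if "a \<in> Dub1 m ` Sym_code {1..t} C" for a
    using that Dub1_stab stab_permutes by blast
  show "id \<in> Dub1 m ` Sym_code {1..t} C"
    using subgroup.one_closed[OF Sym] by (metis Dub1_id imageI one_perm_group)
  show "a \<circ> b \<in> Dub1 m ` Sym_code {1..t} C"
    if ab: "a \<in> Dub1 m ` Sym_code {1..t} C" "b \<in> Dub1 m ` Sym_code {1..t} C" for a b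
  proof -
    obtain p q where pq: "p \<in> Sym_code {1..t} C" "q \<in> Sym_code {1..t} C" "a = Dub1 m p" "b = Dub1 m q"
      using ab by blast
    then have "q permutes {1..t}" by (simp add: Sym_code_def)
    then show ?thesis
      using pq subgroup.m_closed[OF Sym pq(1,2)] by (simp add: Dub1_comp[symmetric])
  qed
  show "inv_into UNIV a \<in> Dub1 m ` Sym_code {1..t} C" if a: "a \<in> Dub1 m ` Sym_code {1..t} C" for a
  proof -
    obtain p where p: "p \<in> Sym_code {1..t} C" "a = Dub1 m p"
      using a by blast
    then have "p permutes {1..t}" by (simp add: Sym_code_def)
    then show ?thesis
      using p subgroup.m_inv_closed[OF Sym p(1)] by (simp add: inv_Dub1 inv_perm_group)
  qed
qed

lemma subgroup_Dub2: "subgroup (Dub2 t ` Sym_code {1..m} D) P"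
proof (rule subgroup_perm_groupI)
  note Sym = subgroup_Sym_code[of "{1..m}" D]
  show "a permutes coords" if "a \<in> Dub2 t ` Sym_code {1..m} D" for a
    using that Dub2_stab stab_permutes by blast
  show "id \<in> Dub2 t ` Sym_code {1..m} D"
    using subgroup.one_closed[OF Sym] by (metis Dub2_id imageI one_perm_group)
  show "a \<circ> b \<in> Dub2 t ` Sym_code {1..m} D"
    if ab: "a \<in> Dub2 t ` Sym_code {1..m} D" "b \<in> Dub2 t ` Sym_code {1..m} D" for a b
  proof -
    obtain p q where pq: "p \<in> Sym_code {1..m} D" "q \<in> Sym_code {1..m} D" "a = Dub2 t p" "b = Dub2 t q"
      using ab by blast
    then have "q permutes {1..m}" by (simp add: Sym_code_def)
    then show ?thesis
      using pq subgroup.m_closed[OF Sym pq(1,2)] by (simp add: Dub2_comp[symmetric])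
  qed
  show "inv_into UNIV a \<in> Dub2 t ` Sym_code {1..m} D" if a: "a \<in> Dub2 t ` Sym_code {1..m} D" for a
  proof -
    obtain p where p: "p \<in> Sym_code {1..m} D" "a = Dub2 t p"
      using a by blast
    then have "p permutes {1..m}" by (simp add: Sym_code_def)
    then show ?thesis
      using p subgroup.m_inv_closed[OF Sym p(1)] by (simp add: inv_Dub2 inv_perm_group)
  qed
qed

lemma Dub_commute:
  assumes "p permutes {1..t}" "q permutes {1..m}"
  shows "Dub2 t q \<circ> Dub1 m p = Dub1 m p \<circ> Dub2 t q"
proof -
  have "r \<le> t \<Longrightarrow> p r \<le> t" "r > t \<Longrightarrow> p r = r" for r
    using permutes_in_image[OF assms(1), of r] permutes_not_in[OF assms(1), of r] by (cases "r = 0"; auto)+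
  moreover have "s \<le> m \<Longrightarrow> q s \<le> m" "s > m \<Longrightarrow> q s = s" for s
    using permutes_in_image[OF assms(2), of s] permutes_not_in[OF assms(2), of s] by (cases "s = 0"; auto)+
  ultimately show ?thesis
    by (auto simp: Dub1_def Dub2_def fun_eq_iff)
qed

subsection \<open>The pointwise stabilizer of the first row and of the set of rows\<close>

text \<open>A description without generators of the normal factor; equality with the generated group
  is \<open>row_kernel_eq\<close>.\<close>

definition row_kernel :: "(nat \<times> nat \<Rightarrow> nat \<times> nat) set" where
  "row_kernel = {\<sigma> \<in> stab. (\<forall>s. \<sigma> (0, s) = (0, s)) \<and> (\<forall>q. fst (\<sigma> q) = fst q)}"

lemma row_kernelI:
  "\<sigma> \<in> stab \<Longrightarrow> (\<And>s. \<sigma> (0, s) = (0, s)) \<Longrightarrow> (\<And>q. fst (\<sigma> q) = fst q) \<Longrightarrow> \<sigma> \<in> row_kernel"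
  unfolding row_kernel_def by blast

lemma row_kernelD:
  assumes "\<sigma> \<in> row_kernel"
  shows "\<sigma> \<in> stab" "\<sigma> (0, s) = (0, s)" "fst (\<sigma> q) = fst q"
  using assms unfolding row_kernel_def by blast+

lemma subgroup_row_kernel: "subgroup row_kernel P"
proof (rule subgroup_perm_groupI)
  show "\<sigma> permutes coords" if "\<sigma> \<in> row_kernel" for \<sigma>
    using that by (simp add: row_kernel_def stab_permutes)
  have "id \<in> stab"
    using subgroup.one_closed[OF subgroup_Stab_Sym] by (metis one_perm_group)
  then show "id \<in> row_kernel"
    by (simp add: row_kernel_def)
  show "\<sigma> \<circ> \<tau> \<in> row_kernel" if "\<sigma> \<in> row_kernel" "\<tau> \<in> row_kernel" for \<sigma> \<tau>
    using that by (intro row_kernelI) (simp_all add: row_kernelD stab_comp)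
  show "inv_into UNIV \<sigma> \<in> row_kernel" if "\<sigma> \<in> row_kernel" for \<sigma>
  proof -
    have \<sigma>: "\<sigma> permutes coords" "\<And>s. \<sigma> (0, s) = (0, s)" "\<And>q. fst (\<sigma> q) = fst q"
      using row_kernelD[OF that] stab_permutes by blast+
    have "inv_into UNIV \<sigma> (0, s) = (0, s)" for s
      using permutes_inverses(2)[OF \<sigma>(1), of "(0, s)"] \<sigma>(2) by simp
    moreover have "fst (inv_into UNIV \<sigma> q) = fst q" for q
      using \<sigma>(3)[of "inv_into UNIV \<sigma> q"] permutes_inverses(1)[OF \<sigma>(1)] by simp
    ultimately show ?thesis
      using stab_inv[OF row_kernelD(1)[OF that]] by (intro row_kernelI)
  qed
qed

text \<open>Both defining properties survive conjugation by any stabilizer element that maps rows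
  into rows. The hypothesis \<open>row\<close> is restricted to coordinates because
  \<open>Dub1 m p\<close> is the identity in columns beyond \<open>m\<close> and therefore need not
  respect rows there.\<close>

lemma row_kernel_conj:
  assumes \<tau>: "\<tau> \<in> stab" and \<sigma>: "\<sigma> \<in> row_kernel"
    and row: "\<And>q q'. q \<in> coords \<Longrightarrow> q' \<in> coords \<Longrightarrow> fst q = fst q' \<Longrightarrow> fst (\<tau> q) = fst (\<tau> q')"
  shows "\<tau> \<circ> \<sigma> \<circ> inv_into UNIV \<tau> \<in> row_kernel"
proof -
  have perm: "\<tau> permutes coords"
    using \<tau> by (rule stab_permutes)
  have in_stab: "\<tau> \<circ> \<sigma> \<circ> inv_into UNIV \<tau> \<in> stab"
    using \<tau> \<sigma> by (simp add: row_kernel_def stab_comp stab_inv)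
  have "(\<tau> \<circ> \<sigma> \<circ> inv_into UNIV \<tau>) (0, s) = (0, s)" for s
  proof -
    have "fst (inv_into UNIV \<tau> (0, s)) = 0"
      using stab_inv[OF \<tau>] by (simp add: mem_stab_iff)
    then have "\<sigma> (inv_into UNIV \<tau> (0, s)) = inv_into UNIV \<tau> (0, s)"
      using \<sigma> by (cases "inv_into UNIV \<tau> (0, s)") (simp add: row_kernel_def)
    then show ?thesis
      using permutes_inverses(1)[OF perm] by simp
  qed
  moreover have "fst ((\<tau> \<circ> \<sigma> \<circ> inv_into UNIV \<tau>) q) = fst q" for q
  proof (cases "q \<in> coords")
    case True
    then have "inv_into UNIV \<tau> q \<in> coords"
      using permutes_in_image[OF permutes_inv[OF perm]] by blast
    moreover from this have "\<sigma> (inv_into UNIV \<tau> q) \<in> coords"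
      using permutes_in_image[OF stab_permutes[OF row_kernelD(1)[OF \<sigma>]]] by blast
    ultimately show ?thesis
      using row[OF _ _ row_kernelD(3)[OF \<sigma>], of "inv_into UNIV \<tau> q"] permutes_inverses(1)[OF perm]
      by simp
  next
    case False
    then show ?thesis
      using permutes_not_in[OF stab_permutes[OF in_stab]] by simp
  qed
  ultimately show ?thesis
    using in_stab by (intro row_kernelI)
qed

text \<open>The codeword with support \<open>{(r, 0), (r, a), (0, a)}\<close> forces \<open>\<sigma>\<close> to map rows to rows and
  to act on each row as a translation of the Steiner loop.\<close>

lemma stab_fix_row0:
  assumes \<sigma>: "\<sigma> \<in> stab" and fix0: "\<And>s. \<sigma> (0, s) = (0, s)" and r: "r \<in> {1..t}" and a: "a \<le> m"
  shows "\<sigma> (r, a) = (fst (\<sigma> (r, 0)), steiner_loop D (snd (\<sigma> (r, 0))) a)"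
    and "fst (\<sigma> (r, 0)) \<in> {1..t}" "snd (\<sigma> (r, 0)) \<le> m"
proof -
  have perm: "\<sigma> permutes coords"
    using \<sigma> by (rule stab_permutes)
  have img: "fst (\<sigma> (r, b)) \<in> {1..t} \<and> snd (\<sigma> (r, b)) \<le> m" if "b \<le> m" for b
  proof -
    have "(r, b) \<in> coords" using r that by (simp add: mem_coords_iff)
    then have mem: "\<sigma> (r, b) \<in> coords"
      using permutes_in_image[OF perm] by blast
    \<comment> \<open>Row 0 is fixed pointwise, so each of its points is already the image of
      itself.\<close>
    have "fst (\<sigma> (r, b)) \<noteq> 0"
    proof
      assume *: "fst (\<sigma> (r, b)) = 0"
      have "\<sigma> (r, b) = \<sigma> (0, snd (\<sigma> (r, b)))"
        using * by (simp add: fix0 prod_eq_iff)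
      from injD[OF permutes_inj[OF perm] this] show False using r by (simp only: prod.inject) simp
    qed
    with mem show ?thesis
      by (cases "\<sigma> (r, b)") (auto simp: mem_coords_iff)
  qed
  then show "fst (\<sigma> (r, 0)) \<in> {1..t}" "snd (\<sigma> (r, 0)) \<le> m"
    by blast+
  show "\<sigma> (r, a) = (fst (\<sigma> (r, 0)), steiner_loop D (snd (\<sigma> (r, 0))) a)"
  proof (cases "a = 0")
    case False
    let ?S = "{(r, 0), (r, a), (0, a)}"
    have sum: "(\<Sum>q\<in>?S. f q) = f (r, 0) + (f (r, a) + f (0, a))" for f :: "nat \<times> nat \<Rightarrow> nat \<Rightarrow> bit"
      using False r by simp
    have "?S \<subseteq> coords" "(\<Sum>q\<in>?S. \<delta> (fst q)) \<in> C" "(\<Sum>q\<in>?S. \<delta> (snd q)) \<in> D"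
      unfolding sum using r a False C.zero_mem D.zero_mem
      by (auto simp: mem_coords_iff vec_add_self)
    note img_sums = stab_blocks[OF \<sigma> this, unfolded sum]
    \<comment> \<open>The fixed point \<open>(0, a)\<close> adds nothing to the first parity, which
      leaves a codeword of weight at most 2.\<close>
    have "fst (\<sigma> (r, 0)) = fst (\<sigma> (r, a))"
      using img_sums(1) img[of 0] img[OF a] by (intro C.unit_vec_add_mem_imp_eq) (auto simp: fix0)
    moreover have "steiner_loop D (snd (\<sigma> (r, 0))) a = snd (\<sigma> (r, a))"
      using img_sums(2) img[of 0] img[OF a] a
      by (subst D.steiner_loop_eq_iff) (auto simp: fix0 ac_simps)
    ultimately show ?thesis
      by (simp add: prod_eq_iff)
  qed simp
qed

end

section \<open>Subloops, and loop products as sums modulo the kernel\<close>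

context perfect_code0
begin

lemma lin_elems_closed:
  assumes a: "a \<in> lin_elems" and b: "b \<in> lin_elems"
  shows "steiner_loop C a b \<in> lin_elems"
proof (rule lin_elemsI)
  note le = lin_elems_le[OF a] lin_elems_le[OF b]
  show "steiner_loop C a b \<le> n"
    using le by (rule steiner_loop_le)
  fix s assume s: "s \<le> n"
  \<comment> \<open>The witness that associativity would suggest for the product of
    \<open>a\<close>, \<open>b\<close> and \<open>s\<close>; in the sum of the three kernel words
    below, \<open>a\<close>, \<open>b\<close> and the inner product cancel.\<close>
  define k where "k = steiner_loop C a (steiner_loop C b s)"
  have "(\<delta> a + \<delta> b + \<delta> (steiner_loop C a b)) + (\<delta> b + \<delta> s + \<delta> (steiner_loop C b s))
      + (\<delta> a + \<delta> (steiner_loop C b s) + \<delta> k) \<in> Ker"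
    unfolding k_def using le s
    by (intro Ker_add lin_elems_Ker[OF a] lin_elems_Ker[OF b] steiner_loop_le)
  then have "\<delta> (steiner_loop C a b) + \<delta> s + \<delta> k \<in> Ker"
    by (simp add: vec_simps)
  moreover have "k \<le> n"
    using le s by (simp add: k_def steiner_loop_le)
  ultimately show "\<exists>k \<le> n. \<delta> (steiner_loop C a b) + \<delta> s + \<delta> k \<in> Ker" by blast
qed

text \<open>Closure under the loop operation is stated modulo the kernel, where the operation is addition.\<close>

definition subloop :: "nat set \<Rightarrow> bool" where
  "subloop H \<longleftrightarrow> H \<subseteq> lin_elems \<and> 0 \<in> H \<and> (\<forall>a \<in> H. \<forall>b \<in> H. \<exists>c \<in> H. \<delta> a + \<delta> b + \<delta> c \<in> Ker)"

text \<open>An iterated loop product inside \<open>H\<close> collapses to a single element; modulo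
  the kernel neither order nor bracketing matters.\<close>

lemma subloop_sum:
  assumes H: "subloop H" and f: "\<And>x. x \<in> S \<Longrightarrow> f x \<in> H"
  shows "\<exists>k \<in> H. (\<Sum>x\<in>S. \<delta> (f x)) + \<delta> k \<in> Ker"
  using f
proof (induction S rule: infinite_finite_induct)
  case (insert x S)
  then obtain k where k: "k \<in> H" "(\<Sum>x\<in>S. \<delta> (f x)) + \<delta> k \<in> Ker"
    by (meson insertI2)
  obtain c where c: "c \<in> H" "\<delta> (f x) + \<delta> k + \<delta> c \<in> Ker"
    using H k(1) insert.prems unfolding subloop_def by blast
  have "(\<Sum>x\<in>insert x S. \<delta> (f x)) + \<delta> c
      = ((\<Sum>x\<in>S. \<delta> (f x)) + \<delta> k) + (\<delta> (f x) + \<delta> k + \<delta> c)"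
    using insert.hyps by (simp add: vec_simps)
  with c Ker_add[OF k(2) c(2)] show ?case by metis
qed (use H in \<open>auto simp: subloop_def intro!: bexI[of _ 0]\<close>)

text \<open>Modulo the kernel each element of the extension is
  \<open>\<delta> e + \<delta> k\<close> with \<open>e \<in> {0, h}\<close> and
  \<open>k \<in> H\<close>. The sum of two such \<open>\<delta> e\<close> is again \<open>0\<close>
  or \<open>\<delta> h\<close>, as everything has order 2; so one coset of \<open>H\<close>
  suffices.\<close>

lemma subloop_extend:
  assumes H: "subloop H" and h: "h \<in> lin_elems"
  shows "subloop (H \<union> steiner_loop C h ` H)" (is "subloop ?H")
proof -
  have H': "H \<subseteq> lin_elems" "0 \<in> H"
    using H by (simp_all add: subloop_def)
  have decomp: "\<exists>k \<in> H. \<exists>e \<in> {0, h}. \<delta> x + \<delta> e + \<delta> k \<in> Ker" if x: "x \<in> ?H" for x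
  proof (cases "x \<in> H")
    case True
    then show ?thesis by (intro bexI[of _ x] bexI[of _ 0]) (simp_all add: vec_simps)
  next
    case False
    then obtain k where k: "k \<in> H" "x = steiner_loop C h k"
      using x by blast
    then have "\<delta> h + \<delta> k + \<delta> x \<in> Ker"
      using lin_elems_Ker[OF h] H' lin_elems_le by blast
    then show ?thesis
      using k by (intro bexI[of _ k] bexI[of _ h]) (simp_all add: ac_simps)
  qed
  have "\<exists>z \<in> ?H. \<delta> x + \<delta> y + \<delta> z \<in> Ker" if xy: "x \<in> ?H" "y \<in> ?H" for x y
  proof -
    obtain k e where k: "k \<in> H" "e \<in> {0, h}" "\<delta> x + \<delta> e + \<delta> k \<in> Ker"
      using decomp[OF xy(1)] by blast
    obtain k' e' where k': "k' \<in> H" "e' \<in> {0, h}" "\<delta> y + \<delta> e' + \<delta> k' \<in> Ker"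
      using decomp[OF xy(2)] by blast
    obtain c where c: "c \<in> H" "\<delta> k + \<delta> k' + \<delta> c \<in> Ker"
      using H k(1) k'(1) unfolding subloop_def by blast
    obtain e'' where e'': "e'' \<in> {0, h}" "\<delta> e'' = \<delta> e + \<delta> e'"
    proof (cases "e = e'")
      case True
      then show ?thesis using that[of 0] by (simp add: vec_add_self)
    next
      case False
      then show ?thesis using that[of h] k(2) k'(2) by auto
    qed
    define z where "z = steiner_loop C e'' c"
    have "\<delta> e'' + \<delta> c + \<delta> z \<in> Ker"
      unfolding z_def using e''(1) h H' c(1) lin_elems_le by (intro lin_elems_Ker) auto
    from Ker_add[OF Ker_add[OF Ker_add[OF k(3) k'(3)] c(2)] this]
    have "(\<delta> x + \<delta> e + \<delta> k) + (\<delta> y + \<delta> e' + \<delta> k') + (\<delta> k + \<delta> k' + \<delta> c) + (\<delta> e'' + \<delta> c + \<delta> z) \<in> Ker" .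
    then have "\<delta> x + \<delta> y + \<delta> z \<in> Ker"
      unfolding e''(2) by (simp add: vec_simps)
    moreover have "z \<in> ?H"
      using e''(1) c(1) by (auto simp: z_def)
    ultimately show ?thesis by blast
  qed
  moreover have "?H \<subseteq> lin_elems"
    using H' h lin_elems_closed by blast
  ultimately show ?thesis
    using H' unfolding subloop_def by blast
qed

end

text \<open>Only the parity of the number of copies of \<open>v\<close> matters. This turns
  orthogonality to a dual word into the vanishing, or survival, of one unit vector.\<close>

lemma sum_if_bit:
  fixes v :: "'i \<Rightarrow> bit"
  shows "(\<Sum>x\<in>S. if g x = (1 :: bit) then v else 0) = (if (\<Sum>x\<in>S. g x) = 1 then v else 0)"
proof (rule ext)
  fix i
  have "(\<Sum>x\<in>S. if g x = 1 then v else 0) i = (\<Sum>x\<in>S. g x * v i)"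
    unfolding sum_fun_apply by (intro sum.cong refl) (auto simp del: mult_bit_eq_and)
  also have "\<dots> = (\<Sum>x\<in>S. g x) * v i"
    by (rule sum_distrib_right[symmetric])
  also have "\<dots> = (if (\<Sum>x\<in>S. g x) = 1 then v else 0) i"
    by (cases "\<Sum>x\<in>S. g x") (simp_all del: mult_bit_eq_and)
  finally show "(\<Sum>x\<in>S. if g x = 1 then v else 0) i = (if (\<Sum>x\<in>S. g x) = 1 then v else 0) i" .
qed

context mollard_pair
begin

abbreviation "dual \<equiv> dual_code {1..t} C"

abbreviation "translation_group \<equiv> generate P (Ort_set m D (Lin_mu m D) dual)"

subsection \<open>The maps \<open>Ort\<close>\<close>

lemma Ort_apply: "Ort m D l u (r, s) = (if r \<in> supp u \<and> s \<le> m then (r, steiner_loop D s l) else (r, s))"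
  by (simp add: Ort_def)

lemma supp_dual: "u \<in> dual \<Longrightarrow> supp u \<subseteq> {1..t}"
  using supp_subset by (auto simp: dual_code_def)

text \<open>Orthogonality in the form needed for blocks: indices \<open>f x\<close> may repeat,
  since a block may meet a row several times, and may be 0, where \<open>u\<close> vanishes.\<close>

lemma dual_sum:
  assumes u: "u \<in> dual" and S: "(\<Sum>x\<in>S. \<delta> (f x)) \<in> C" "\<And>x. x \<in> S \<Longrightarrow> f x \<le> t"
  shows "(\<Sum>x\<in>S. u (f x)) = 0"
proof -
  have u0: "u 0 = 0"
    using u by (auto simp: dual_code_def vectors_def)
  have "(\<Sum>i\<in>{1..t}. u i * \<delta> k i) = u k" if "k \<le> t" for k
  proof -
    have "(\<Sum>i\<in>{1..t}. u i * \<delta> k i) = (\<Sum>i\<in>{1..t}. if i = k then u k else 0)"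
      by (intro sum.cong refl) (auto simp: unit_vec_def simp del: mult_bit_eq_and)
    then show ?thesis
      using that u0 by (cases "k = 0") auto
  qed
  then have "(\<Sum>x\<in>S. u (f x)) = (\<Sum>x\<in>S. \<Sum>i\<in>{1..t}. u i * \<delta> (f x) i)"
    using S(2) by (intro sum.cong refl) (simp del: mult_bit_eq_and)
  also have "\<dots> = (\<Sum>i\<in>{1..t}. u i * (\<Sum>x\<in>S. \<delta> (f x)) i)"
    unfolding sum_fun_apply sum_distrib_left by (rule sum.swap)
  also have "\<dots> = 0"
    using u S(1) unfolding dual_code_def by blast
  finally show ?thesis .
qed

lemma Ort_involution: "l \<le> m \<Longrightarrow> Ort m D l u \<circ> Ort m D l u = id"
  by (auto simp: fun_eq_iff Ort_apply D.steiner_loop_le D.steiner_loop_cancel)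

lemma inv_Ort: "l \<le> m \<Longrightarrow> inv_into UNIV (Ort m D l u) = Ort m D l u"
  by (rule inv_unique_comp) (simp_all add: Ort_involution)

lemma Ort_permutes:
  assumes "l \<le> m" "u \<in> dual"
  shows "Ort m D l u permutes coords"
proof (rule permutesI_inverse[OF _ Ort_involution Ort_involution])
  show "Ort m D l u x = x" if "x \<notin> coords" for x
    using that supp_dual[OF assms(2)] by (cases x) (auto simp: Ort_apply mem_coords_iff)
qed (use assms in auto)

text \<open>Modulo the kernel, every point in a row of \<open>supp u\<close> changes the second
  parity by \<open>\<delta> l\<close>. The number of such points in a block is even because its
  first parity lies in \<open>C\<close> and \<open>u\<close> is orthogonal to \<open>C\<close>; so
  the second parity changes by a kernel word only.\<close>

lemma Ort_in_row_kernel: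
  assumes l: "l \<in> D.lin_elems" and u: "u \<in> dual"
  shows "Ort m D l u \<in> row_kernel"
proof (rule row_kernelI)
  note le = D.lin_elems_le[OF l]
  have supp_iff: "r \<in> supp u \<longleftrightarrow> u r = 1" for r
    by (simp add: supp_def)
  have "0 \<notin> supp u"
    using supp_dual[OF u] by auto
  then show row0: "Ort m D l u (0, s) = (0, s)" for s
    by (simp add: Ort_apply)
  show fst: "fst (Ort m D l u q) = fst q" for q
    by (cases q) (simp add: Ort_apply)
  have "(\<Sum>q\<in>S. \<delta> (snd (Ort m D l u q))) \<in> D" if S: "S \<in> blocks" for S
  proof -
    let ?shift = "\<lambda>q :: nat \<times> nat. if u (fst q) = 1 then \<delta> l else 0"
    have "\<delta> (snd (Ort m D l u q)) + (\<delta> (snd q) + ?shift q) \<in> D.Ker" if "q \<in> S" for q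
    proof -
      obtain r s where q: "q = (r, s)" "s \<le> m"
        using block_cases[OF S] \<open>q \<in> S\<close> by (cases q) auto
      show ?thesis
        using D.lin_elems_Ker[OF l q(2)] D.steiner_loop_commute[OF le q(2)] q
        by (auto simp: Ort_apply supp_iff vec_simps)
    qed
    then have "(\<Sum>q\<in>S. \<delta> (snd (Ort m D l u q)) + (\<delta> (snd q) + ?shift q)) \<in> D.Ker"
      by (rule D.Ker_sum)
    moreover have "(\<Sum>q\<in>S. ?shift q) = 0"
    proof -
      have "(\<Sum>q\<in>S. u (fst q)) = 0"
        using S block_cases[OF S] by (intro dual_sum[OF u]) (auto simp: blocks_def)
      then show ?thesis
        by (simp add: sum_if_bit)
    qed
    ultimately have "(\<Sum>q\<in>S. \<delta> (snd (Ort m D l u q))) + (\<Sum>q\<in>S. \<delta> (snd q)) \<in> D.Ker"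
      by (simp add: sum.distrib)
    moreover have "(\<Sum>q\<in>S. \<delta> (snd q)) \<in> D"
      using S by (simp add: blocks_def)
    ultimately have "(\<Sum>q\<in>S. \<delta> (snd (Ort m D l u q))) + (\<Sum>q\<in>S. \<delta> (snd q)) + (\<Sum>q\<in>S. \<delta> (snd q)) \<in> D"
      unfolding D.mem_Ker_iff by blast
    then show ?thesis
      by (simp add: add.assoc vec_add_self)
  qed
  then show "Ort m D l u \<in> stab"
    using Ort_permutes[OF le u] by (simp add: mem_stab_iff fst row0 blocks_def)
qed

lemma Ort_set_subset: "Ort_set m D (Lin_mu m D) dual \<subseteq> row_kernel"
  using Ort_in_row_kernel by (auto simp: Ort_set_def D.Lin_mu_eq)

lemma translation_group_subset: "translation_group \<subseteq> row_kernel"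
  using group.generate_subgroup_incl[OF group_perm_group Ort_set_subset subgroup_row_kernel] .

lemma subgroup_translation_group: "subgroup translation_group P"
  using Ort_set_subset row_kernelD(1) stab_permutes
  by (intro group.generate_is_subgroup[OF group_perm_group]) auto

subsection \<open>Elements of the kernel are products of maps \<open>Ort\<close>\<close>

text \<open>The translation element \<open>\<lambda>\<^sub>r\<close>, read off at column 0 because 0
  is the identity of the loop.\<close>

definition shift :: "(nat \<times> nat \<Rightarrow> nat \<times> nat) \<Rightarrow> nat \<Rightarrow> nat" where
  "shift \<sigma> r = snd (\<sigma> (r, 0))"

lemma row_kernel_apply:
  assumes "\<sigma> \<in> row_kernel" "r \<in> {1..t}" "a \<le> m"
  shows "\<sigma> (r, a) = (r, steiner_loop D (shift \<sigma> r) a)"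
  using stab_fix_row0(1)[OF row_kernelD(1,2)[OF assms(1)] assms(2,3)] row_kernelD(3)[OF assms(1), of "(r, 0)"]
  by (simp add: shift_def)

lemma shift_le: "\<sigma> \<in> row_kernel \<Longrightarrow> r \<in> {1..t} \<Longrightarrow> shift \<sigma> r \<le> m"
  unfolding shift_def by (rule stab_fix_row0(3)[OF row_kernelD(1,2), where a = 0]) simp_all

lemma sum_row0_Un:
  fixes R :: "(nat \<times> 'b) set"
  assumes "finite S" "finite R" "R \<subseteq> {1..} \<times> UNIV"
  shows "(\<Sum>q\<in>{0} \<times> S \<union> R. f q) = (\<Sum>s\<in>S. f (0, s)) + (\<Sum>q\<in>R. f q)"
proof -
  have "(\<Sum>q\<in>{0} \<times> S \<union> R. f q) = (\<Sum>q\<in>{0} \<times> S. f q) + (\<Sum>q\<in>R. f q)"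
    using assms(1,2) by (intro sum.union_disjoint) (auto dest!: subsetD[OF assms(3)])
  then show ?thesis
    by (simp add: sum_row0)
qed

text \<open>Given any \<open>y\<close> in \<open>D\<close>, \<open>R\<close> is completed by points
  of row 0 to a block with second parity \<open>y\<close>. These points do not affect the first
  parity and are fixed by \<open>\<sigma>\<close>, so the image has second parity \<open>y\<close>
  plus the change on \<open>R\<close>. As \<open>y\<close> is arbitrary, that change lies in the
  kernel.\<close>

lemma row_kernel_Ker:
  assumes \<sigma>: "\<sigma> \<in> row_kernel" and R: "R \<subseteq> coords" "R \<subseteq> {1..} \<times> UNIV" "(\<Sum>q\<in>R. \<delta> (fst q)) \<in> C"
  shows "(\<Sum>q\<in>R. \<delta> (snd q)) + (\<Sum>q\<in>R. \<delta> (snd (\<sigma> q))) \<in> D.Ker"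
proof -
  have finR: "finite R"
    using R(1) finite_coords by (rule finite_subset)
  have "(\<Sum>q\<in>R. \<delta> (snd q)) + (\<Sum>q\<in>R. \<delta> (snd (\<sigma> q))) + y \<in> D" if y: "y \<in> D" for y
  proof -
    \<comment> \<open>Chosen so that row 0 filled by \<open>x\<close>, together with
      \<open>R\<close>, has second parity exactly \<open>y\<close>.\<close>
    define x where "x = y + (\<Sum>q\<in>R. \<delta> (snd q))"
    have "(\<Sum>q\<in>R. \<delta> (snd q)) \<in> vectors {1..m}"
      using R(1) by (auto simp: vectors_def sum_fun_apply unit_vec_def mem_coords_iff intro!: sum.neutral)
    then have x: "x \<in> vectors {1..m}"
      unfolding x_def using D.mem_vectors[OF y] by (intro add_in_vectors)
    have suppx: "supp x \<subseteq> {1..m}" "finite (supp x)"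
      using supp_subset[OF x] finite_subset by auto
    let ?S = "{0} \<times> supp x \<union> R"
    have fst_sum: "(\<Sum>q\<in>?S. \<delta> (fst q)) \<in> C"
      using R(3) by (simp add: sum_row0_Un[OF suppx(2) finR R(2)])
    have "(\<Sum>q\<in>?S. \<delta> (snd q)) = x + (\<Sum>q\<in>R. \<delta> (snd q))"
      by (simp add: sum_row0_Un[OF suppx(2) finR R(2)] vec_eq_sum[OF x])
    also have "\<dots> = y"
      by (simp add: x_def vec_simps)
    finally have snd_sum: "(\<Sum>q\<in>?S. \<delta> (snd q)) \<in> D"
      using y by simp
    have "?S \<subseteq> coords"
      using suppx R(1) by (auto simp: mem_coords_iff)
    from stab_blocks(2)[OF row_kernelD(1)[OF \<sigma>] this fst_sum snd_sum]
    have "x + (\<Sum>q\<in>R. \<delta> (snd (\<sigma> q))) \<in> D"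
      by (simp add: sum_row0_Un[OF suppx(2) finR R(2)] row_kernelD(2)[OF \<sigma>] vec_eq_sum[OF x])
    then show ?thesis
      by (simp add: x_def ac_simps)
  qed
  then show ?thesis
    by (simp add: D.mem_Ker_iff)
qed

text \<open>Two points of the same row have first parity zero, so \<open>row_kernel_Ker\<close>
  applies to the pair \<open>(r, 0)\<close>, \<open>(r, s)\<close> and yields the required kernel
  word.\<close>

lemma shift_lin_elems:
  assumes \<sigma>: "\<sigma> \<in> row_kernel" and r: "r \<in> {1..t}"
  shows "shift \<sigma> r \<in> D.lin_elems"
proof (rule D.lin_elemsI)
  show le: "shift \<sigma> r \<le> m"
    using \<sigma> r by (rule shift_le)
  fix s assume s: "s \<le> m"
  let ?k = "steiner_loop D (shift \<sigma> r) s"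
  have "\<delta> (shift \<sigma> r) + \<delta> s + \<delta> ?k \<in> D.Ker"
  proof (cases "s = 0")
    case True
    then show ?thesis by (simp add: vec_add_self)
  next
    case False
    let ?R = "{(r, 0), (r, s)}"
    have sum: "(\<Sum>q\<in>?R. f q) = f (r, 0) + f (r, s)" for f :: "nat \<times> nat \<Rightarrow> nat \<Rightarrow> bit"
      using False by simp
    have "(\<Sum>q\<in>?R. \<delta> (snd q)) + (\<Sum>q\<in>?R. \<delta> (snd (\<sigma> q))) \<in> D.Ker"
      using r s C.zero_mem by (intro row_kernel_Ker[OF \<sigma>]) (auto simp: sum mem_coords_iff vec_add_self)
    then show ?thesis
      using row_kernel_apply[OF \<sigma> r s] unfolding sum by (simp add: shift_def ac_simps)
  qed
  then show "\<exists>k \<le> m. \<delta> (shift \<sigma> r) + \<delta> s + \<delta> k \<in> D.Ker"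
    using D.steiner_loop_le[OF le s] by blast
qed

lemma sum_column0: "(\<Sum>q\<in>(\<lambda>r. (r, 0)) ` T. f q) = (\<Sum>r\<in>T. f (r, 0 :: nat))"
  by (simp add: sum.reindex inj_on_def)

text \<open>A copy of \<open>c\<close> in column 0 has first parity \<open>c\<close> and second
  parity zero, so after applying \<open>\<sigma>\<close> only the shifts remain.\<close>

lemma shift_sum_Ker:
  assumes \<sigma>: "\<sigma> \<in> row_kernel" and c: "c \<in> C"
  shows "(\<Sum>r\<in>supp c. \<delta> (shift \<sigma> r)) \<in> D.Ker"
proof -
  let ?R = "(\<lambda>r. (r, 0)) ` supp c"
  have "(\<Sum>q\<in>?R. \<delta> (snd q)) + (\<Sum>q\<in>?R. \<delta> (snd (\<sigma> q))) \<in> D.Ker"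
    using C.supp_codeword[OF c] c
    by (intro row_kernel_Ker[OF \<sigma>])
      (auto simp: mem_coords_iff sum_column0 vec_eq_sum[OF C.mem_vectors])
  then show ?thesis
    by (simp add: sum_column0 shift_def)
qed

text \<open>Induction along a chain of subloops: if the shifts lie in \<open>H \<union> h \<star> H\<close>, the rows whose shift
  lies outside \<open>H\<close> form a word \<open>u\<close> of the dual code, and multiplying by \<open>Ort m D h u\<close> moves all
  shifts into \<open>H\<close>.\<close>

lemma translation_group_extend:
  assumes H: "D.subloop H" and h: "h \<in> D.lin_elems" "h \<notin> H"
    and IH: "\<And>\<sigma>. \<sigma> \<in> row_kernel \<Longrightarrow> (\<And>r. r \<in> {1..t} \<Longrightarrow> shift \<sigma> r \<in> H) \<Longrightarrow> \<sigma> \<in> translation_group"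
    and \<sigma>: "\<sigma> \<in> row_kernel" and shifts: "\<And>r. r \<in> {1..t} \<Longrightarrow> shift \<sigma> r \<in> H \<union> steiner_loop D h ` H"
  shows "\<sigma> \<in> translation_group"
proof -
  note hm = D.lin_elems_le[OF h(1)]
  have H_le: "k \<le> m" if "k \<in> H" for k
    using H that D.lin_elems_le unfolding D.subloop_def by blast
  define u :: "nat \<Rightarrow> bit" where "u = (\<lambda>r. if r \<in> {1..t} \<and> shift \<sigma> r \<notin> H then 1 else 0)"
  have supp_u: "r \<in> supp u \<longleftrightarrow> r \<in> {1..t} \<and> shift \<sigma> r \<notin> H" for r
    by (simp add: supp_def u_def)
  \<comment> \<open>The shifts that will remain after composing with \<open>Ort m D h u\<close>: a
    factor \<open>h\<close> is removed wherever the shift lies outside \<open>H\<close>.\<close>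
  define \<mu> where "\<mu> = (\<lambda>r. if u r = 1 then steiner_loop D (shift \<sigma> r) h else shift \<sigma> r)"
  have \<mu>H: "\<mu> r \<in> H" if r: "r \<in> {1..t}" for r
  proof (cases "shift \<sigma> r \<in> H")
    case True
    then show ?thesis by (simp add: \<mu>_def u_def)
  next
    case False
    then obtain k where k: "k \<in> H" "shift \<sigma> r = steiner_loop D h k"
      using shifts[OF r] by blast
    then have "steiner_loop D (shift \<sigma> r) h = k"
      using D.steiner_loop_commute[OF hm H_le] D.steiner_loop_cancel[OF H_le hm] by simp
    then show ?thesis
      using False r k(1) by (simp add: \<mu>_def u_def)
  qed
  have step: "\<delta> (shift \<sigma> r) + ((if u r = 1 then \<delta> h else 0) + \<delta> (\<mu> r)) \<in> D.Ker" if r: "r \<in> {1..t}" for r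
    using D.lin_elems_Ker[OF h(1) shift_le[OF \<sigma> r]] D.steiner_loop_commute[OF hm shift_le[OF \<sigma> r]]
    by (auto simp: \<mu>_def vec_simps)
  \<comment> \<open>An odd number of moved rows in \<open>supp c\<close> would leave one
    \<open>\<delta> h\<close>. The shifts sum to zero modulo the kernel and the
    \<open>\<mu> r\<close> sum to some \<open>k\<close> in \<open>H\<close>, so \<open>h\<close>
    would equal \<open>k\<close>, contradicting \<open>h \<notin> H\<close>.\<close>
  have "(\<Sum>i\<in>{1..t}. u i * c i) = 0" if c: "c \<in> C" for c
  proof (rule ccontr)
    assume "(\<Sum>i\<in>{1..t}. u i * c i) \<noteq> 0"
    moreover have "(\<Sum>i\<in>{1..t}. u i * c i) = (\<Sum>i\<in>supp c. u i * c i)"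
      using C.supp_codeword[OF c] by (intro sum.mono_neutral_right) (auto simp: supp_def)
    moreover have "\<dots> = (\<Sum>i\<in>supp c. u i)"
      by (intro sum.cong refl) (simp add: supp_def)
    ultimately have one: "(\<Sum>i\<in>supp c. u i) = 1"
      by simp
    have "(\<Sum>r\<in>supp c. \<delta> (shift \<sigma> r) + ((if u r = 1 then \<delta> h else 0) + \<delta> (\<mu> r))) \<in> D.Ker"
      using C.supp_codeword[OF c] by (intro D.Ker_sum step) blast
    then have "(\<Sum>r\<in>supp c. \<delta> (shift \<sigma> r)) + (\<delta> h + (\<Sum>r\<in>supp c. \<delta> (\<mu> r))) \<in> D.Ker"
      by (simp add: sum.distrib sum_if_bit one)
    note sum_shift = this
    obtain k where k: "k \<in> H" "(\<Sum>r\<in>supp c. \<delta> (\<mu> r)) + \<delta> k \<in> D.Ker"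
      using D.subloop_sum[OF H, of "supp c" \<mu>] \<mu>H C.supp_codeword[OF c] by blast
    from D.Ker_add[OF D.Ker_add[OF sum_shift shift_sum_Ker[OF \<sigma> c]] k(2)]
    have "((\<Sum>r\<in>supp c. \<delta> (shift \<sigma> r)) + (\<delta> h + (\<Sum>r\<in>supp c. \<delta> (\<mu> r))))
        + (\<Sum>r\<in>supp c. \<delta> (shift \<sigma> r)) + ((\<Sum>r\<in>supp c. \<delta> (\<mu> r)) + \<delta> k) \<in> D.Ker" .
    then have "\<delta> h + \<delta> k \<in> D.Ker"
      by (simp add: vec_simps)
    then have "h = k"
      using hm H_le[OF k(1)] by (intro D.unit_vec_add_Ker_imp_eq)
    with k(1) h(2) show False by simp
  qed
  moreover have "u \<in> vectors {1..t}"
    by (simp add: vectors_def u_def)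
  ultimately have u: "u \<in> dual"
    unfolding dual_code_def by blast
  define \<tau> where "\<tau> = Ort m D h u"
  have \<tau>: "\<tau> \<in> row_kernel"
    unfolding \<tau>_def using h(1) u by (rule Ort_in_row_kernel)
  \<comment> \<open>Needed because the generators use \<open>Lin_mu\<close>, which omits the
    adjoined identity.\<close>
  have "h \<noteq> 0"
    using H h(2) unfolding D.subloop_def by metis
  then have \<tau>N: "\<tau> \<in> translation_group"
    using h(1) u by (intro generate.incl) (auto simp: \<tau>_def Ort_set_def D.Lin_mu_eq)
  have "\<sigma> \<circ> \<tau> \<in> row_kernel"
    using subgroup.m_closed[OF subgroup_row_kernel \<sigma> \<tau>] by simp
  moreover have "shift (\<sigma> \<circ> \<tau>) r \<in> H" if r: "r \<in> {1..t}" for r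
    using \<mu>H[OF r] row_kernel_apply[OF \<sigma> r hm]
    by (auto simp: \<tau>_def shift_def Ort_apply supp_def \<mu>_def split: if_splits)
  ultimately have "\<sigma> \<circ> \<tau> \<in> translation_group"
    by (rule IH)
  then have "(\<sigma> \<circ> \<tau>) \<circ> \<tau> \<in> translation_group"
    using subgroup.m_closed[OF subgroup_translation_group _ \<tau>N] by simp
  then show ?thesis
    using Ort_involution[OF hm] by (simp add: \<tau>_def o_assoc[symmetric])
qed

text \<open>For the nontrivial inclusion, the induction runs over finite sets \<open>F\<close> of
  linear elements and produces a subloop containing \<open>F\<close> for which the claim holds.
  Starting from \<open>{0}\<close>, where only the identity map remains, it reaches all of
  \<open>lin_elems\<close>, to which every shift belongs.\<close>

lemma row_kernel_eq: "translation_group = row_kernel"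
proof
  have chain: "\<exists>H. F \<subseteq> H \<and> D.subloop H \<and>
      (\<forall>\<sigma> \<in> row_kernel. (\<forall>r \<in> {1..t}. shift \<sigma> r \<in> H) \<longrightarrow> \<sigma> \<in> translation_group)"
    if "finite F" "F \<subseteq> D.lin_elems" for F
    using that
  proof (induction F rule: finite_induct)
    case empty
    have "\<sigma> \<in> translation_group" if \<sigma>: "\<sigma> \<in> row_kernel" and shifts: "\<forall>r \<in> {1..t}. shift \<sigma> r \<in> {0}" for \<sigma>
    proof -
      have "\<sigma> q = q" for q
      proof (cases "q \<in> coords")
        case True
        obtain r s where q: "q = (r, s)" by (cases q)
        show ?thesis
        proof (cases "r = 0")
          case True
          then show ?thesis using row_kernelD(2)[OF \<sigma>] q by simp
        next
          case False
          then have "r \<in> {1..t}" "s \<le> m"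
            using \<open>q \<in> coords\<close> q by (auto simp: mem_coords_iff)
          then show ?thesis
            using row_kernel_apply[OF \<sigma>, of r s] shifts q by simp
        qed
      next
        case False
        then show ?thesis
          using permutes_not_in[OF stab_permutes[OF row_kernelD(1)[OF \<sigma>]]] by blast
      qed
      then have "\<sigma> = \<one>\<^bsub>P\<^esub>" by (simp add: fun_eq_iff)
      then show ?thesis
        using generate.one by metis
    qed
    moreover have "D.subloop {0}"
      by (simp add: D.subloop_def)
    ultimately show ?case by blast
  next
    case (insert h F)
    then obtain H where H: "F \<subseteq> H" "D.subloop H"
      "\<And>\<sigma>. \<sigma> \<in> row_kernel \<Longrightarrow> (\<And>r. r \<in> {1..t} \<Longrightarrow> shift \<sigma> r \<in> H) \<Longrightarrow> \<sigma> \<in> translation_group"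
      by auto
    show ?case
    proof (cases "h \<in> H")
      case True
      then show ?thesis using H by (intro exI[of _ H]) blast
    next
      case False
      let ?H = "H \<union> steiner_loop D h ` H"
      have h: "h \<in> D.lin_elems"
        using insert.prems by simp
      have "steiner_loop D h 0 \<in> steiner_loop D h ` H"
        using H(2) by (intro imageI) (simp add: D.subloop_def)
      then have "insert h F \<subseteq> ?H"
        using H(1) by auto
      moreover have "D.subloop ?H"
        using H(2) h by (rule D.subloop_extend)
      moreover have "\<sigma> \<in> translation_group" if "\<sigma> \<in> row_kernel" "\<forall>r \<in> {1..t}. shift \<sigma> r \<in> ?H" for \<sigma>
        using that by (intro translation_group_extend[OF H(2) h False H(3)]) auto
      ultimately show ?thesis by blast
    qed
  qed
  have "finite D.lin_elems"
    using finite_subset[of D.lin_elems "{..m}"] D.lin_elems_le by auto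
  from chain[OF this order_refl] obtain H where H: "D.lin_elems \<subseteq> H"
    "\<forall>\<sigma> \<in> row_kernel. (\<forall>r \<in> {1..t}. shift \<sigma> r \<in> H) \<longrightarrow> \<sigma> \<in> translation_group"
    by (elim exE conjE)
  show "row_kernel \<subseteq> translation_group"
  proof
    fix \<sigma> assume \<sigma>: "\<sigma> \<in> row_kernel"
    then have "\<forall>r \<in> {1..t}. shift \<sigma> r \<in> H"
      using shift_lin_elems H(1) by blast
    then show "\<sigma> \<in> translation_group"
      by (rule mp[OF bspec[OF H(2) \<sigma>]])
  qed
qed (rule translation_group_subset)

subsection \<open>The factorization\<close>

lemma Dub1_apply: "p 0 = 0 \<Longrightarrow> s \<le> m \<Longrightarrow> Dub1 m p (r, s) = (p r, s)"
  by (auto simp: Dub1_def)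

lemma Dub2_apply: "p 0 = 0 \<Longrightarrow> r \<le> t \<Longrightarrow> Dub2 t p (r, s) = (r, p s)"
  by (auto simp: Dub2_def)

lemma Sym_code_permutes: "p \<in> Sym_code I E \<Longrightarrow> p permutes I"
  by (simp add: Sym_code_def)

lemma permutes_0: "p permutes {1..k :: nat} \<Longrightarrow> p 0 = 0"
  by (simp add: permutes_not_in)

lemma Sym_code_Dub1_conj:
  assumes "p \<in> Sym_code {1..t} C" "\<sigma> \<in> row_kernel"
  shows "Dub1 m p \<circ> \<sigma> \<circ> inv_into UNIV (Dub1 m p) \<in> row_kernel"
proof (rule row_kernel_conj[OF Dub1_stab[OF assms(1)] assms(2)])
  have "p 0 = 0"
    by (rule permutes_0[OF Sym_code_permutes[OF assms(1)]])
  then show "fst (Dub1 m p q) = fst (Dub1 m p q')"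
    if "q \<in> coords" "q' \<in> coords" "fst q = fst q'" for q q'
    using that by (cases q; cases q') (auto simp: Dub1_apply mem_coords_iff)
qed

lemma Sym_code_Dub2_conj:
  assumes "p \<in> Sym_code {1..m} D" "\<sigma> \<in> row_kernel"
  shows "Dub2 t p \<circ> \<sigma> \<circ> inv_into UNIV (Dub2 t p) \<in> row_kernel"
  by (rule row_kernel_conj[OF Dub2_stab[OF assms(1)] assms(2)]) (auto simp: Dub2_def)

text \<open>Row 0 sees only \<open>q\<close>, and the row indices along column 0 see only
  \<open>p\<close>.\<close>

lemma Dub_in_row_kernel_imp_id:
  assumes p: "p permutes {1..t}" and q: "q permutes {1..m}"
    and mem: "Dub2 t q \<circ> Dub1 m p \<in> row_kernel"
  shows "p = id" "q = id"
proof -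
  note 0 = permutes_0[OF p] permutes_0[OF q]
  have "q s = s" for s
    using row_kernelD(2)[OF mem, of s] 0 by (auto simp: Dub1_def Dub2_def split: if_splits)
  then show q_id: "q = id" by (simp add: fun_eq_iff)
  have "p r = r" for r
    using row_kernelD(3)[OF mem, of "(r, 0)"] 0 by (simp add: q_id Dub1_apply)
  then show "p = id" by (simp add: fun_eq_iff)
qed

lemma stab_row0:
  assumes \<sigma>: "\<sigma> \<in> stab"
  obtains p where "p \<in> Sym_code {1..m} D" "\<And>s. \<sigma> (0, s) = (0, p s)"
proof
  define p where "p = (\<lambda>s. snd (\<sigma> (0, s)))"
  show p: "\<sigma> (0, s) = (0, p s)" for s
    using \<sigma> by (simp add: p_def mem_stab_iff prod_eq_iff)
  note perm = stab_permutes[OF \<sigma>]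
  have coord: "s \<in> {1..m} \<longleftrightarrow> (0, s) \<in> coords" for s
    by (auto simp: mem_coords_iff)
  have "inj_on p {1..m}"
  proof (rule inj_onI)
    fix s s' assume "p s = p s'"
    then have "\<sigma> (0, s) = \<sigma> (0, s')" by (simp add: p)
    then show "s = s'"
      using permutes_inj[OF perm] by (simp add: inj_eq)
  qed
  moreover have "p ` {1..m} \<subseteq> {1..m}"
    unfolding image_subset_iff coord using permutes_in_image[OF perm] by (metis p coord)
  ultimately have "bij_betw p {1..m} {1..m}"
    by (simp add: bij_betw_def endo_inj_surj)
  moreover have "p s = s" if "s \<notin> {1..m}" for s
    using permutes_not_in[OF perm, of "(0, s)"] that unfolding coord by (simp add: p)
  ultimately have permp: "p permutes {1..m}"
    by (rule bij_imp_permutes)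
  have "perm_vec p x \<in> D" if x: "x \<in> D" for x
  proof -
    have supp: "supp x \<subseteq> {1..m}" "finite (supp x)"
      using D.supp_codeword[OF x] finite_subset by auto
    note vx = vec_eq_sum[OF D.mem_vectors[OF x]]
    have "(\<Sum>q\<in>{0} \<times> supp x. \<delta> (snd (\<sigma> q))) \<in> D"
      using supp x C.zero_mem
      by (intro stab_blocks(2)[OF \<sigma>]) (auto simp: sum_row0 vx mem_coords_iff)
    also have "(\<Sum>q\<in>{0} \<times> supp x. \<delta> (snd (\<sigma> q))) = perm_vec p (\<Sum>s\<in>supp x. \<delta> s)"
      by (simp add: sum_row0 p perm_vec_unit_sum[OF permp])
    finally show ?thesis
      by (simp add: vx)
  qed
  then show "p \<in> Sym_code {1..m} D"
    using permp D.finite_code by (simp add: Sym_code_iff)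
qed

lemma stab_rows:
  assumes \<sigma>: "\<sigma> \<in> stab" and fix0: "\<And>s. \<sigma> (0, s) = (0, s)"
  obtains p where "p \<in> Sym_code {1..t} C" "\<And>q. q \<in> coords \<Longrightarrow> fst (\<sigma> q) = p (fst q)"
proof
  note \<sigma>_apply = stab_fix_row0[OF \<sigma> fix0]
  \<comment> \<open>The default \<open>r\<close> makes \<open>p\<close> a permutation of
    \<open>{1..t}\<close> and also gives the correct row for row 0.\<close>
  define p where "p = (\<lambda>r. if r \<in> {1..t} then fst (\<sigma> (r, 0)) else r)"
  have p: "\<sigma> (r, s) = (p r, steiner_loop D (snd (\<sigma> (r, 0))) s)" if "r \<in> {1..t}" "s \<le> m" for r s
    using \<sigma>_apply(1)[OF that] that by (simp add: p_def)
  show "fst (\<sigma> q) = p (fst q)" if q: "q \<in> coords" for q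
  proof -
    obtain r s where rs: "q = (r, s)" "r \<le> t" "s \<le> m"
      using q by (cases q) (auto simp: mem_coords_iff)
    then show ?thesis
      using p[of r s] by (cases "r = 0") (auto simp: p_def fix0)
  qed
  have "inj_on p {1..t}"
  proof (rule inj_onI)
    fix r r' assume r: "r \<in> {1..t}" "r' \<in> {1..t}" "p r = p r'"
    let ?l = "snd (\<sigma> (r, 0))" and ?l' = "snd (\<sigma> (r', 0))"
    have le: "?l \<le> m" "?l' \<le> m"
      using \<sigma>_apply(3) r by blast+
    \<comment> \<open>Loop translations are onto: \<open>a\<close> solves the equation saying that
      \<open>\<sigma> (r', a)\<close> has the same column as \<open>\<sigma> (r, 0)\<close>. If both
      rows had the same image row, injectivity of \<open>\<sigma>\<close> would be violated unless
      \<open>r = r'\<close>.\<close>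
    define a where "a = steiner_loop D ?l ?l'"
    have a: "a \<le> m"
      unfolding a_def using le by (rule D.steiner_loop_le)
    have "steiner_loop D ?l' a = steiner_loop D a ?l'"
      using le(2) a by (rule D.steiner_loop_commute)
    also have "\<dots> = ?l"
      unfolding a_def using le by (rule D.steiner_loop_cancel)
    finally have a_l: "steiner_loop D ?l' a = ?l" .
    have "\<sigma> (r, 0) = \<sigma> (r', a)"
      using p[of r 0] p[of r' a] r a a_l by simp
    then show "r = r'"
      using permutes_inj[OF stab_permutes[OF \<sigma>]] by (simp add: inj_eq)
  qed
  moreover have "p ` {1..t} \<subseteq> {1..t}"
    using \<sigma>_apply(2)[of _ 0] by (auto simp: p_def)
  ultimately have "bij_betw p {1..t} {1..t}"
    by (simp add: bij_betw_def endo_inj_surj)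
  then have permp: "p permutes {1..t}"
    by (rule bij_imp_permutes) (auto simp: p_def)
  have "perm_vec p c \<in> C" if c: "c \<in> C" for c
  proof -
    note supp = C.supp_codeword[OF c] and vc = vec_eq_sum[OF C.mem_vectors[OF c]]
    have "(\<Sum>q\<in>(\<lambda>r. (r, 0)) ` supp c. \<delta> (fst (\<sigma> q))) \<in> C"
      using supp c D.zero_mem
      by (intro stab_blocks(1)[OF \<sigma>]) (auto simp: sum_column0 vc mem_coords_iff)
    also have "(\<Sum>q\<in>(\<lambda>r. (r, 0)) ` supp c. \<delta> (fst (\<sigma> q))) = (\<Sum>r\<in>supp c. \<delta> (p r))"
      unfolding sum_column0 using supp by (intro sum.cong refl) (auto simp: p_def)
    also have "\<dots> = perm_vec p (\<Sum>r\<in>supp c. \<delta> r)"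
      by (simp add: perm_vec_unit_sum[OF permp])
    finally show ?thesis
      by (simp add: vc)
  qed
  then show "p \<in> Sym_code {1..t} C"
    using permp C.finite_code by (simp add: Sym_code_iff)
qed

text \<open>The factor from \<open>D\<close> is split off on the left first, because
  \<open>stab_rows\<close> applies only once row 0 is fixed pointwise.\<close>

lemma stab_factor:
  assumes \<sigma>: "\<sigma> \<in> stab"
  shows "\<exists>b \<in> Dub2 t ` Sym_code {1..m} D. \<exists>a \<in> Dub1 m ` Sym_code {1..t} C. \<exists>n \<in> row_kernel.
    \<sigma> = b \<circ> (a \<circ> n)"
proof -
  obtain q where q: "q \<in> Sym_code {1..m} D" "\<And>s. \<sigma> (0, s) = (0, q s)"
    using stab_row0[OF \<sigma>] by blast
  define b where "b = Dub2 t q"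
  have b: "b \<in> stab"
    unfolding b_def using q(1) by (rule Dub2_stab)
  have permb: "b permutes coords"
    using b by (rule stab_permutes)
  define \<sigma>' where "\<sigma>' = inv_into UNIV b \<circ> \<sigma>"
  have \<sigma>': "\<sigma>' \<in> stab"
    unfolding \<sigma>'_def using stab_inv[OF b] \<sigma> by (rule stab_comp)
  have fix0: "\<sigma>' (0, s) = (0, s)" for s
  proof -
    have "q 0 = 0"
      by (rule permutes_0[OF Sym_code_permutes[OF q(1)]])
    then have "\<sigma> (0, s) = b (0, s)"
      by (simp add: b_def Dub2_apply q(2))
    then show ?thesis
      using permutes_inverses(2)[OF permb, of "(0, s)"] by (simp add: \<sigma>'_def)
  qed
  obtain p where p: "p \<in> Sym_code {1..t} C" "\<And>x. x \<in> coords \<Longrightarrow> fst (\<sigma>' x) = p (fst x)"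
    using stab_rows[OF \<sigma>' fix0] by blast
  have permp: "p permutes {1..t}"
    using p(1) by (simp add: Sym_code_def)
  define a where "a = Dub1 m p"
  have a: "a \<in> stab"
    unfolding a_def using p(1) by (rule Dub1_stab)
  have perma: "a permutes coords"
    using a by (rule stab_permutes)
  define n where "n = inv_into UNIV a \<circ> \<sigma>'"
  have n: "n \<in> stab"
    unfolding n_def using stab_inv[OF a] \<sigma>' by (rule stab_comp)
  have an: "a (n x) = \<sigma>' x" for x
    unfolding n_def using permutes_inverses(1)[OF perma] by simp
  have "n \<in> row_kernel"
  proof (rule row_kernelI[OF n])
    show "n (0, s) = (0, s)" for s
    proof -
      have "a (0, s) = a (n (0, s))"
        by (simp add: an fix0) (simp add: a_def Dub1_def)
      then show ?thesis
        using permutes_inj[OF perma] by (simp add: inj_eq)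
    qed
    show "fst (n x) = fst x" for x
    proof (cases "x \<in> coords")
      case True
      then have "n x \<in> coords"
        using permutes_in_image[OF stab_permutes[OF n]] by blast
      then have "fst (a (n x)) = p (fst (n x))"
        using permutes_0[OF permp] by (cases "n x") (simp add: a_def Dub1_apply mem_coords_iff)
      then have "p (fst (n x)) = p (fst x)"
        using p(2)[OF True] by (simp add: an)
      then show ?thesis
        using permutes_inj[OF permp] by (simp add: inj_eq)
    next
      case False
      then show ?thesis
        using permutes_not_in[OF stab_permutes[OF n]] by simp
    qed
  qed
  moreover have "\<sigma> = b \<circ> (a \<circ> n)"
    using permutes_inverses(1)[OF permb] by (simp add: fun_eq_iff an \<sigma>'_def)
  ultimately show ?thesis
    using p(1) q(1) unfolding a_def b_def by blast
qed

subsection \<open>When the second factor is normal\<close>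

text \<open>The permutation acts additively on words and sends \<open>\<delta> k\<close> to
  \<open>\<delta> (q k)\<close>, so it carries the defining codeword of a product to that of the
  image product. As \<open>q 0 = 0\<close>, degenerate products are included.\<close>

lemma steiner_loop_Sym_code:
  assumes q: "q \<in> Sym_code {1..m} D" and le: "i \<le> m" "j \<le> m"
  shows "q (steiner_loop D i j) = steiner_loop D (q i) (q j)"
proof -
  have perm: "q permutes {1..m}" and img: "\<And>x. x \<in> D \<Longrightarrow> perm_vec q x \<in> D"
    using q D.finite_code by (simp_all add: Sym_code_iff)
  have q_le: "q k \<le> m" if "k \<le> m" for k
    using permutes_in_image[OF perm, of k] permutes_0[OF perm] that by (cases "k = 0") auto
  have unit: "perm_vec q (\<delta> k) = \<delta> (q k)" for k
    using perm_vec_unit_sum[OF perm, of id "{k}"] by simp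
  have add: "perm_vec q (x + y) = perm_vec q x + perm_vec q y" for x y
    by (rule ext) (simp only: perm_vec_def plus_fun_apply)
  have "\<delta> (q i) + \<delta> (q j) + \<delta> (q (steiner_loop D i j)) \<in> D"
    using img[OF D.steiner_loop_mem[OF le]] by (simp only: add unit)
  then show ?thesis
    using D.steiner_loop_eq_iff q_le le D.steiner_loop_le by metis
qed

text \<open>If \<open>r\<close> is in the support of a dual word \<open>u\<close>, then
  \<open>Ort m D l u\<close> sends \<open>(r, 0)\<close> to \<open>(r, l)\<close>; commuting with
  \<open>Dub2 t p\<close> there forces \<open>p l = l\<close>. Conversely, a loop automorphism
  fixing \<open>l\<close> commutes with translation by \<open>l\<close>, and with a zero dual code
  all maps \<open>Ort\<close> are the identity.\<close>

lemma Dub2_commute_iff: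
  "(\<forall>b \<in> Dub2 t ` Sym_code {1..m} D. \<forall>n \<in> translation_group. b \<circ> n = n \<circ> b) \<longleftrightarrow>
    dual = {0} \<or> (\<forall>p \<in> Sym_code {1..m} D. \<forall>l \<in> Lin_mu m D. p l = l)"
proof
  assume comm: "\<forall>b \<in> Dub2 t ` Sym_code {1..m} D. \<forall>n \<in> translation_group. b \<circ> n = n \<circ> b"
  show "dual = {0} \<or> (\<forall>p \<in> Sym_code {1..m} D. \<forall>l \<in> Lin_mu m D. p l = l)"
  proof (cases "dual = {0}")
    case True
    then show ?thesis ..
  next
    case False
    moreover have "0 \<in> dual"
      by (simp add: dual_code_def vectors_def)
    ultimately obtain u where u: "u \<in> dual" "u \<noteq> 0" by blast
    then obtain r where r: "r \<in> supp u"
      by (auto simp: supp_def fun_eq_iff)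
    then have "r \<in> {1..t}"
      using supp_dual[OF u(1)] by blast
    have "\<forall>p \<in> Sym_code {1..m} D. \<forall>l \<in> Lin_mu m D. p l = l"
    proof (intro ballI)
      fix p l assume p: "p \<in> Sym_code {1..m} D" and l: "l \<in> Lin_mu m D"
      have "Ort m D l u \<in> translation_group"
        using l u(1) by (intro generate.incl) (auto simp: Ort_set_def)
      with comm p have "Dub2 t p (Ort m D l u (r, 0)) = Ort m D l u (Dub2 t p (r, 0))"
        by (metis comp_apply imageI)
      moreover have "p 0 = 0"
        by (rule permutes_0[OF Sym_code_permutes[OF p]])
      ultimately show "p l = l"
        using r \<open>r \<in> {1..t}\<close> by (simp add: Ort_apply Dub2_apply)
    qed
    then show ?thesis ..
  qed
next
  assume triv: "dual = {0} \<or> (\<forall>p \<in> Sym_code {1..m} D. \<forall>l \<in> Lin_mu m D. p l = l)"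
  have gen: "Dub2 t p \<circ> Ort m D l u = Ort m D l u \<circ> Dub2 t p"
    if p: "p \<in> Sym_code {1..m} D" and l: "l \<in> Lin_mu m D" and u: "u \<in> dual" for p l u
    using triv
  proof
    assume "dual = {0}"
    with u have "supp u = {}" by (simp add: supp_def)
    then have "Ort m D l u = id" by (simp add: fun_eq_iff Ort_apply)
    then show ?thesis by simp
  next
    assume fixed: "\<forall>p \<in> Sym_code {1..m} D. \<forall>l \<in> Lin_mu m D. p l = l"
    have perm: "p permutes {1..m}"
      using p by (simp add: Sym_code_def)
    have lm: "l \<le> m" and pl: "p l = l"
      using fixed p l by (simp_all add: Lin_mu_def)
    have p_le: "p s \<le> m \<longleftrightarrow> s \<le> m" for s
      using permutes_in_image[OF perm, of s] permutes_not_in[OF perm, of s] permutes_0[OF perm]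
      by (cases "s \<in> {1..m}") auto
    show ?thesis
    proof (rule ext)
      fix x :: "nat \<times> nat"
      obtain r s where x: "x = (r, s)" by (cases x)
      show "(Dub2 t p \<circ> Ort m D l u) x = (Ort m D l u \<circ> Dub2 t p) x"
      proof (cases "r \<le> t")
        case True
        then show ?thesis
          using steiner_loop_Sym_code[OF p _ lm, of s]
          by (simp add: pl x Ort_apply Dub2_apply[of p, OF permutes_0[OF perm]] p_le)
      next
        case False
        then have "r \<notin> supp u"
          using supp_dual[OF u] by auto
        with False show ?thesis
          by (simp add: x Ort_apply Dub2_def)
      qed
    qed
  qed
  have "b \<circ> n = n \<circ> b"
    if "n \<in> translation_group" and b: "b \<in> Dub2 t ` Sym_code {1..m} D" for b n
    using that(1)
  proof (induction rule: generate.induct)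
    case one
    show ?case by simp
  next
    case (incl h)
    then obtain l u where "h = Ort m D l u" "l \<in> Lin_mu m D" "u \<in> dual"
      unfolding Ort_set_def by blast
    then show ?case using gen b by blast
  next
    \<comment> \<open>The generators are involutions, so their inverses are again
      generators.\<close>
    case (inv h)
    then obtain l u where h: "h = Ort m D l u" "l \<in> Lin_mu m D" "u \<in> dual"
      unfolding Ort_set_def by blast
    then have "l \<le> m" by (simp add: Lin_mu_def)
    then have "inv\<^bsub>P\<^esub> h = h"
      using h by (simp add: inv_perm_group Ort_permutes inv_Ort)
    moreover have "b \<circ> h = h \<circ> b"
      using gen h b by blast
    ultimately show ?case by (simp only:)
  next
    case (eng h1 h2)
    have "b \<circ> (h1 \<circ> h2) = h1 \<circ> b \<circ> h2"
      unfolding o_assoc eng.IH(1) ..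
    also have "\<dots> = h1 \<circ> h2 \<circ> b"
      unfolding comp_assoc eng.IH(2) ..
    finally show ?case
      unfolding mult_perm_group .
  qed
  then show "\<forall>b \<in> Dub2 t ` Sym_code {1..m} D. \<forall>n \<in> translation_group. b \<circ> n = n \<circ> b"
    by blast
qed

end

text \<open>\<open>B\<close> centralizes \<open>A\<close> but in general only normalizes
  \<open>N\<close>, so the outer product is asserted as a semidirect one, in both bracketings. The
  last conjunct says exactly when it is direct in the literal sense.\<close>

theorem theorem2:
  fixes t m :: nat and C D :: "(nat \<Rightarrow> bit) set"
  assumes "3 \<le> t" and "perfect_code {1..t} C" and "0 \<in> C"
    and "3 \<le> m" and "perfect_code {1..m} D" and "0 \<in> D"
  defines "P \<equiv> perm_group (mollard_coords t m)"
  defines "G \<equiv> Stab_Sym (mollard_coords t m) (embed2 m ` D) (mollard t m C D)"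
  defines "A \<equiv> Dub1 m ` Sym_code {1..t} C"
  defines "N \<equiv> generate P (Ort_set m D (Lin_mu m D) (dual_code {1..t} C))"
  defines "B \<equiv> Dub2 t ` Sym_code {1..m} D"
  shows "internal_semidirect_product P A N (A <#>\<^bsub>P\<^esub> N)
    \<and> internal_semidirect_product P B (A <#>\<^bsub>P\<^esub> N) G
    \<and> internal_direct_product P A B (A <#>\<^bsub>P\<^esub> B)
    \<and> internal_semidirect_product P (A <#>\<^bsub>P\<^esub> B) N G
    \<and> (internal_direct_product P (A <#>\<^bsub>P\<^esub> N) B G \<longleftrightarrow>
         dual_code {1..t} C = {0} \<or> (\<forall>p \<in> Sym_code {1..m} D. \<forall>l \<in> Lin_mu m D. p l = l))"
proof -
  interpret mollard_pair t C m D
    using assms by (simp add: mollard_pair_def perfect_code0_def)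
  interpret P: group "perm_group (mollard_coords t m)"
    by (rule group_perm_group)
  have N: "N = row_kernel"
    unfolding N_def P_def by (rule row_kernel_eq)
  have permA: "p permutes {1..t}" if "p \<in> Sym_code {1..t} C" for p
    using that by (simp add: Sym_code_def)
  have permB: "p permutes {1..m}" if "p \<in> Sym_code {1..m} D" for p
    using that by (simp add: Sym_code_def)
  have subgroups: "subgroup A P" "subgroup B P" "subgroup N P" "subgroup G P"
    unfolding A_def B_def P_def G_def N
    by (rule subgroup_Dub1 subgroup_Dub2 subgroup_row_kernel subgroup_Stab_Sym)+
  have incl: "A \<subseteq> G" "B \<subseteq> G" "N \<subseteq> G"
    using Dub1_stab Dub2_stab row_kernelD(1) unfolding A_def B_def G_def N by blast+
  have comm: "b \<otimes>\<^bsub>P\<^esub> a = a \<otimes>\<^bsub>P\<^esub> b" if "a \<in> A" "b \<in> B" for a b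
    using that Dub_commute permA permB unfolding A_def B_def P_def by auto
  have conjA: "a \<otimes>\<^bsub>P\<^esub> n \<otimes>\<^bsub>P\<^esub> inv\<^bsub>P\<^esub> a \<in> N" if "a \<in> A" "n \<in> N" for a n
    using that Sym_code_Dub1_conj Dub1_permutes permA
    unfolding A_def P_def N by (auto simp: inv_perm_group)
  have conjB: "b \<otimes>\<^bsub>P\<^esub> n \<otimes>\<^bsub>P\<^esub> inv\<^bsub>P\<^esub> b \<in> N" if "b \<in> B" "n \<in> N" for b n
    using that Sym_code_Dub2_conj Dub2_permutes permB
    unfolding B_def P_def N by (auto simp: inv_perm_group)
  have cover: "\<exists>b \<in> B. \<exists>a \<in> A. \<exists>n \<in> N. g = b \<otimes>\<^bsub>P\<^esub> (a \<otimes>\<^bsub>P\<^esub> n)" if "g \<in> G" for g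
    using stab_factor that unfolding A_def B_def G_def N P_def by simp
  have triv: "a = \<one>\<^bsub>P\<^esub> \<and> b = \<one>\<^bsub>P\<^esub>"
    if ab: "a \<in> A" "b \<in> B" "b \<otimes>\<^bsub>P\<^esub> a \<in> N" for a b
  proof -
    obtain p q where pq: "p \<in> Sym_code {1..t} C" "a = Dub1 m p" "q \<in> Sym_code {1..m} D" "b = Dub2 t q"
      using ab(1,2) unfolding A_def B_def by blast
    then have "p = id" "q = id"
      using Dub_in_row_kernel_imp_id[OF permA permB, of p q] ab(3) by (simp_all add: N P_def)
    with pq show ?thesis by (simp add: P_def)
  qed
  note products = P.internal_products_of_three[folded P_def, OF subgroups incl comm conjA conjB cover triv]
  have "(\<forall>b \<in> B. \<forall>n \<in> N. b \<otimes>\<^bsub>P\<^esub> n = n \<otimes>\<^bsub>P\<^esub> b) \<longleftrightarrow>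
      dual_code {1..t} C = {0} \<or> (\<forall>p \<in> Sym_code {1..m} D. \<forall>l \<in> Lin_mu m D. p l = l)"
    using Dub2_commute_iff by (simp add: B_def N_def P_def)
  with products show ?thesis
    by blast
qed

end
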